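(* Let $G=(V,E)$ be a simple graph, and let $A_1, A_2 \subseteq E$ be triangle-free 2-matchings in $G$. Then there is a partition $\mathcal{P}$ of $A_1 \bigtriangleup A_2$ into alternating trails with respect to $(A_1, A_2)$ such that $A_i \bigtriangleup P$ is a triangle-free 2-matching for $i=1,2$ and for every $P \in \mathcal{P}$.
   Context: A (simple) 2-matching in $G=(V,E)$ is an edge set $M\subseteq E$ such that every vertex is incident to at most $2$ edges of $M$. A triangle is an edge set forming a cycle of length $3$; a 2-matching is triangle-free if it contains no triangle as a subset. A trail is a sequence of distinct consecutive edges $u_1u_2, u_2u_3, \dots, u_ku_{k+1}$ (the vertices $u_j$ need not be distinct); a trail is identified with its set of edges when convenient. For 2-matchings $A_1, A_2$, a trail is alternating with respect to $(A_1,A_2)$ if it traverses edges of $A_1\setminus A_2$ and $A_2\setminus A_1$ alternately. $\bigtriangleup$ denotes symmetric difference. *)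

theory Defs
  imports "HOL-Library.Disjoint_Sets"
begin

(* Graphs are finite: an alternating trail is a finite sequence, and on infinite graphs
   (e.g. the 4-regular tree) the decomposition need not exist. *)
definition simple_graph :: "'a set \<Rightarrow> 'a set set \<Rightarrow> bool" where
  "simple_graph V E \<longleftrightarrow> finite V \<and> E \<subseteq> {{u, v} | u v. u \<in> V \<and> v \<in> V \<and> u \<noteq> v}"

definition two_matching :: "'a set \<Rightarrow> 'a set set \<Rightarrow> 'a set set \<Rightarrow> bool" where
  "two_matching V E M \<longleftrightarrow> M \<subseteq> E \<and> (\<forall>v\<in>V. card {e \<in> M. v \<in> e} \<le> 2)"

definition is_triangle :: "'a set set \<Rightarrow> bool" where
  "is_triangle T \<longleftrightarrow> (\<exists>u v w. distinct [u, v, w] \<and> T = {{u, v}, {v, w}, {w, u}})"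

definition triangle_free :: "'a set set \<Rightarrow> bool" where
  "triangle_free M \<longleftrightarrow> \<not> (\<exists>T. is_triangle T \<and> T \<subseteq> M)"

definition walk_edges :: "'a list \<Rightarrow> 'a set list" where
  "walk_edges us = map (\<lambda>(u, v). {u, v}) (zip us (tl us))"

definition is_trail :: "'a set set \<Rightarrow> 'a list \<Rightarrow> bool" where
  "is_trail E us \<longleftrightarrow>
     length us \<ge> 2 \<and> set (walk_edges us) \<subseteq> E \<and> distinct (walk_edges us)"

(* The alternation condition is not cyclic: on a closed trail the last and the first edge
   may lie in the same one of the two matchings. *)
definition alternating_trail ::
    "'a set set \<Rightarrow> 'a set set \<Rightarrow> 'a set set \<Rightarrow> 'a list \<Rightarrow> bool" where
  "alternating_trail E A\<^sub>1 A\<^sub>2 us \<longleftrightarrow>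
     is_trail E us \<and>
     set (walk_edges us) \<subseteq> sym_diff A\<^sub>1 A\<^sub>2 \<and>
     (\<forall>i. Suc i < length (walk_edges us) \<longrightarrow>
        (walk_edges us ! i \<in> A\<^sub>1 - A\<^sub>2 \<and> walk_edges us ! Suc i \<in> A\<^sub>2 - A\<^sub>1) \<or>
        (walk_edges us ! i \<in> A\<^sub>2 - A\<^sub>1 \<and> walk_edges us ! Suc i \<in> A\<^sub>1 - A\<^sub>2))"

end

theory Submission
  imports Defs
begin

text \<open>
  Colour the edges of \<open>A\<^sub>1 - A\<^sub>2\<close> red, those of \<open>A\<^sub>2 - A\<^sub>1\<close> blue and the common edges neutral.
  Choose at every vertex a maximum matching between the red and the blue edges there; the classes
  of edges connected by these local matchings are alternating trails, and switching one of them
  keeps both sets 2-matchings, because the matchings are maximum. Triangles stay excluded as soon as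
  every triangle with both a red and a blue edge has such a pair in one trail. This surely holds if
  two edges of the triangle are matched at their common vertex (the triangle is then good). Every
  vertex has at most two maximum matchings, so local choices can be flipped: if the number of good
  triangles is as large as possible, a case analysis shows that every other two-coloured triangle
  lies in a cluster, that is a \<open>K\<^sub>5\<close> minus at most one edge in which one colour contains a path with
  four edges and the other is a 5-cycle. A triangle meeting a cluster lies in it, so clusters are
  disjoint and the matchings can be redefined on each of them separately, such that all edges of the
  cluster belong to a single trail.
\<close>

section \<open>Local matchings of the colours\<close>

text \<open>A term \<open>q u v w\<close> is to be read as: at \<open>u\<close> the red edge to
  \<open>v\<close> is matched to the blue edge to \<open>w\<close>. The six disjuncts run over the
  corners and, at each, over the two orders of the colours.\<close>

definition good :: "('a \<Rightarrow> 'a \<Rightarrow> 'a \<Rightarrow> bool) \<Rightarrow> 'a \<Rightarrow> 'a \<Rightarrow> 'a \<Rightarrow> bool" where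
  "good q u v w \<longleftrightarrow> q u v w \<or> q u w v \<or> q v u w \<or> q v w u \<or> q w u v \<or> q w v u"

lemma good_swap: "good q u v w \<longleftrightarrow> good q v u w"
  unfolding good_def by blast

lemma good_rotate: "good q u v w \<longleftrightarrow> good q v w u"
  unfolding good_def by blast

text \<open>\<open>C\<close> stands for the common edges, so the two matchings are \<open>R\<close>
  with \<open>C\<close> and \<open>B\<close> with \<open>C\<close>. The conditions as a whole are
  symmetric in \<open>R\<close> and \<open>B\<close>, which makes the exchange of colours an
  instance of the same locale.\<close>

locale coloured_graph =
  fixes R B C :: "'a \<Rightarrow> 'a \<Rightarrow> bool"
  assumes R_sym: "R x y \<Longrightarrow> R y x"
    and B_sym: "B x y \<Longrightarrow> B y x"
    and C_sym: "C x y \<Longrightarrow> C y x"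
    and R_irrefl: "\<not> R x x"
    and B_irrefl: "\<not> B x x"
    and C_irrefl: "\<not> C x x"
    and R_not_B: "R x y \<Longrightarrow> \<not> B x y"
    and R_not_C: "R x y \<Longrightarrow> \<not> C x y"
    and B_not_C: "B x y \<Longrightarrow> \<not> C x y"
    and R_degree: "\<lbrakk>R x y1 \<or> C x y1; R x y2 \<or> C x y2; R x y3 \<or> C x y3\<rbrakk>
      \<Longrightarrow> y1 = y2 \<or> y1 = y3 \<or> y2 = y3"
    and B_degree: "\<lbrakk>B x y1 \<or> C x y1; B x y2 \<or> C x y2; B x y3 \<or> C x y3\<rbrakk>
      \<Longrightarrow> y1 = y2 \<or> y1 = y3 \<or> y2 = y3"
    and R_triangle_free: "\<not> ((R x y \<or> C x y) \<and> (R y z \<or> C y z) \<and> (R x z \<or> C x z))"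
    and B_triangle_free: "\<not> ((B x y \<or> C x y) \<and> (B y z \<or> C y z) \<and> (B x z \<or> C x z))"
begin

lemma B_not_R: "B x y \<Longrightarrow> \<not> R x y"
  using R_not_B by blast

lemma swap_colours: "coloured_graph B R C"
  by unfold_locales (fact R_sym B_sym C_sym R_irrefl B_irrefl C_irrefl B_not_R R_not_C B_not_C
    R_degree B_degree R_triangle_free B_triangle_free)+

definition edge :: "'a \<Rightarrow> 'a \<Rightarrow> bool" where
  "edge x y \<longleftrightarrow> R x y \<or> B x y \<or> C x y"

lemma edge_sym: "edge x y \<Longrightarrow> edge y x"
  unfolding edge_def by (metis R_sym B_sym C_sym)

text \<open>
  Since no vertex has more than two red or two blue neighbours, these conditions say that \<open>m\<close> is a
  matching of maximum size between the red and the blue neighbours of \<open>u\<close>. In this form they are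
  visibly preserved by complementing \<open>m\<close> at a vertex with an unmatched pair.
\<close>

definition pairing_at :: "'a \<Rightarrow> ('a \<Rightarrow> 'a \<Rightarrow> bool) \<Rightarrow> bool" where
  "pairing_at u m \<longleftrightarrow>
     (\<forall>a b. m a b \<longrightarrow> R u a \<and> B u b) \<and>
     (\<forall>a a' b. R u a \<longrightarrow> R u a' \<longrightarrow> a \<noteq> a' \<longrightarrow> B u b \<longrightarrow> (m a b \<longleftrightarrow> \<not> m a' b)) \<and>
     (\<forall>a b b'. R u a \<longrightarrow> B u b \<longrightarrow> B u b' \<longrightarrow> b \<noteq> b' \<longrightarrow> (m a b \<longleftrightarrow> \<not> m a b')) \<and>
     (\<forall>a b. R u a \<longrightarrow> B u b \<longrightarrow> (\<forall>a'. R u a' \<longrightarrow> a' = a) \<longrightarrow> (\<forall>b'. B u b' \<longrightarrow> b' = b) \<longrightarrow> m a b)"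

abbreviation pairing :: "('a \<Rightarrow> 'a \<Rightarrow> 'a \<Rightarrow> bool) \<Rightarrow> bool" where
  "pairing q \<equiv> \<forall>u. pairing_at u (q u)"

lemma pairing_colours: "pairing q \<Longrightarrow> q u a b \<Longrightarrow> R u a \<and> B u b"
  unfolding pairing_at_def by blast

lemma pairing_R: "\<lbrakk>pairing q; R u a; R u a'; a \<noteq> a'; B u b\<rbrakk> \<Longrightarrow> q u a b \<longleftrightarrow> \<not> q u a' b"
  unfolding pairing_at_def by blast

lemma pairing_B: "\<lbrakk>pairing q; R u a; B u b; B u b'; b \<noteq> b'\<rbrakk> \<Longrightarrow> q u a b \<longleftrightarrow> \<not> q u a b'"
  unfolding pairing_at_def by blast

lemma pairing_unique:
  "\<lbrakk>pairing q; R u a; B u b; \<And>a'. R u a' \<Longrightarrow> a' = a; \<And>b'. B u b' \<Longrightarrow> b' = b\<rbrakk> \<Longrightarrow> q u a b"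
  unfolding pairing_at_def by blast

text \<open>Each colour has at most two edges at \<open>u\<close>, so one matched pair determines
  the rest: any red neighbour other than \<open>x\<close> goes with the blue neighbour other than
  \<open>y\<close>.\<close>

lemma pairing_at_through:
  assumes "R u x" "B u y"
  shows "pairing_at u (\<lambda>a b. R u a \<and> B u b \<and> (a = x \<longleftrightarrow> b = y))"
  unfolding pairing_at_def
proof (intro conjI allI impI)
  fix a a' b assume "R u a" "R u a'" "a \<noteq> a'" "B u b"
  moreover have "a = x \<or> a' = x" using R_degree assms calculation by blast
  ultimately show "(R u a \<and> B u b \<and> (a = x \<longleftrightarrow> b = y)) \<longleftrightarrow> \<not> (R u a' \<and> B u b \<and> (a' = x \<longleftrightarrow> b = y))"
    by blast
next
  fix a b b' assume "R u a" "B u b" "B u b'" "b \<noteq> b'"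
  moreover have "b = y \<or> b' = y" using B_degree assms calculation by blast
  ultimately show "(R u a \<and> B u b \<and> (a = x \<longleftrightarrow> b = y)) \<longleftrightarrow> \<not> (R u a \<and> B u b' \<and> (a = x \<longleftrightarrow> b' = y))"
    by blast
next
  fix a b assume "\<forall>a'. R u a' \<longrightarrow> a' = a" "\<forall>b'. B u b' \<longrightarrow> b' = b"
  then show "a = x \<longleftrightarrow> b = y" using assms by blast
qed blast+

lemma pairing_exists: "\<exists>q. pairing q"
proof -
  have "\<exists>m. pairing_at u m" for u
  proof (cases "\<exists>x y. R u x \<and> B u y")
    case True
    then show ?thesis using pairing_at_through by blast
  next
    case False
    then have "pairing_at u (\<lambda>a b. False)" unfolding pairing_at_def by blast
    then show ?thesis by blast
  qed
  then show ?thesis by metis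
qed

section \<open>Flipping local matchings\<close>

definition flip where
  "flip F q u a b \<longleftrightarrow> (if u \<in> F then R u a \<and> B u b \<and> \<not> q u a b else q u a b)"

definition improvable where
  "improvable q u v w \<longleftrightarrow> (\<exists>q'. pairing q' \<and> good q' u v w \<and>
     (\<forall>x y z. edge y z \<longrightarrow> q x y z \<longrightarrow> good q' x y z))"

text \<open>A vertex with one red and one blue edge has a single maximum matching and no unmatched
  pair, so it cannot belong to \<open>F\<close>. At a vertex with an unmatched pair the complement
  is again a maximum matching.\<close>

lemma pairing_flip:
  assumes q: "pairing q" and F: "\<And>u. u \<in> F \<Longrightarrow> \<exists>a b. R u a \<and> B u b \<and> \<not> q u a b"
  shows "pairing (flip F q)"
proof
  fix u
  show "pairing_at u (flip F q u)"
  proof (cases "u \<in> F")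
    case False
    then have "flip F q u = q u" by (auto simp: flip_def fun_eq_iff)
    then show ?thesis using q by simp
  next
    case True
    then obtain a0 b0 where o: "R u a0" "B u b0" "\<not> q u a0 b0" using F by blast
    have eq: "flip F q u = (\<lambda>a b. R u a \<and> B u b \<and> \<not> q u a b)"
      using True by (auto simp: flip_def fun_eq_iff)
    show ?thesis unfolding pairing_at_def eq
    proof (intro conjI allI impI)
      fix a a' b assume "R u a" "R u a'" "a \<noteq> a'" "B u b"
      then show "(R u a \<and> B u b \<and> \<not> q u a b) \<longleftrightarrow> \<not> (R u a' \<and> B u b \<and> \<not> q u a' b)"
        using pairing_R[OF q, of u a a' b] by simp
    next
      fix a b b' assume "R u a" "B u b" "B u b'" "b \<noteq> b'"
      then show "(R u a \<and> B u b \<and> \<not> q u a b) \<longleftrightarrow> \<not> (R u a \<and> B u b' \<and> \<not> q u a b')"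
        using pairing_B[OF q, of u a b b'] by simp
    next
      fix a b assume "\<forall>a'. R u a' \<longrightarrow> a' = a" "\<forall>b'. B u b' \<longrightarrow> b' = b"
      then have "a0 = a" "b0 = b" using o by auto
      then show "\<not> q u a b" using o by simp
    qed blast+
  qed
qed

text \<open>Only triangles through exactly one of the edges \<open>ua\<close>, \<open>ub\<close> can
  lose a matched pair at \<open>u\<close>. They are tested against the flip of all of
  \<open>F\<close>, so that simultaneous flips may repair each other's damage.\<close>

definition flippable where
  "flippable F q u a b \<longleftrightarrow> R u a \<and> B u b \<and> \<not> q u a b \<and>
     (\<forall>y. B u y \<longrightarrow> y \<noteq> b \<longrightarrow> edge a y \<longrightarrow> good (flip F q) u a y) \<and>
     (\<forall>y. R u y \<longrightarrow> y \<noteq> a \<longrightarrow> edge y b \<longrightarrow> good (flip F q) u y b)"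

lemma flippableI:
  assumes "R u a" "B u b" "\<not> q u a b"
    and "\<And>y. B u y \<Longrightarrow> y \<noteq> b \<Longrightarrow> edge a y \<Longrightarrow> good (flip F q) u a y"
    and "\<And>y. R u y \<Longrightarrow> y \<noteq> a \<Longrightarrow> edge y b \<Longrightarrow> good (flip F q) u y b"
  shows "flippable F q u a b"
  using assms by (simp add: flippable_def)

text \<open>By the degree bounds a pair matched at a flipped vertex shares exactly one edge with a
  given unmatched pair there, so \<open>flippable\<close> covers every triangle at risk.\<close>

lemma improvableI:
  assumes q: "pairing q"
    and F: "\<And>u. u \<in> F \<Longrightarrow> \<exists>a b. flippable F q u a b"
    and T: "good (flip F q) x y z"
  shows "improvable q x y z"
proof -
  have "pairing (flip F q)" by (rule pairing_flip[OF q]) (meson F flippable_def)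
  moreover have "good (flip F q) u a b" if e: "edge a b" and quab: "q u a b" for u a b
  proof (cases "u \<in> F")
    case False
    then show ?thesis using quab by (simp add: good_def flip_def)
  next
    case True
    from F[OF True] obtain a0 b0 where o: "R u a0" "B u b0" "\<not> q u a0 b0"
      "\<And>y. B u y \<Longrightarrow> y \<noteq> b0 \<Longrightarrow> edge a0 y \<Longrightarrow> good (flip F q) u a0 y"
      "\<And>y. R u y \<Longrightarrow> y \<noteq> a0 \<Longrightarrow> edge y b0 \<Longrightarrow> good (flip F q) u y b0"
      unfolding flippable_def by (elim exE conjE) simp
    have ab: "R u a" "B u b" using pairing_colours[OF q quab] by auto
    consider "a = a0" "b \<noteq> b0" | "a \<noteq> a0" "b = b0"
      using o(1-3) ab quab pairing_R[OF q, of u a a0 b] pairing_B[OF q, of u a0 b b0] by blast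
    then show ?thesis using o ab e by cases auto
  qed
  ultimately show ?thesis using T unfolding improvable_def
    by (intro exI[of _ "flip F q"]) simp
qed

text \<open>The neutral edge \<open>ab\<close> takes one slot of each colour at \<open>a\<close> and
  at \<open>b\<close>. A triangle put at risk by flipping \<open>u\<close> therefore has a corner at
  \<open>a\<close> or \<open>b\<close> with a single red and a single blue edge, which every pairing
  matches.\<close>

lemma improvable_unit:
  assumes q: "pairing q" and e: "R u a" "B u b" "C a b" and bad: "\<not> q u a b"
  shows "improvable q u a b"
proof (rule improvableI[OF q, where F = "{u}"])
  show "good (flip {u} q) u a b" using e bad by (simp add: good_def flip_def)
  fix u' assume "u' \<in> {u}"
  then have [simp]: "u' = u" by simp
  have "good (flip {u} q) u a y" if y: "B u y" "y \<noteq> b" "edge a y" for y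
  proof -
    have "B a y" using y R_degree[of a u b y] e R_sym B_irrefl R_not_C B_not_C
      unfolding edge_def by metis
    moreover have "\<And>x. R a x \<Longrightarrow> x = u"
      using R_degree[of a u b] e R_sym R_not_C R_not_B C_sym B_irrefl by metis
    moreover have "\<And>x. B a x \<Longrightarrow> x = y" using B_degree[of a y b] e y B_not_C calculation by metis
    ultimately have "q a u y" using pairing_unique[OF q] e R_sym by blast
    then show ?thesis using e R_irrefl by (auto simp: good_def flip_def)
  qed
  moreover have "good (flip {u} q) u y b" if y: "R u y" "y \<noteq> a" "edge y b" for y
  proof -
    have "R b y" using y B_degree[of b u a y] e R_sym B_sym C_sym R_irrefl R_not_C B_not_C
      unfolding edge_def by metis
    moreover have "\<And>x. B b x \<Longrightarrow> x = u" using B_degree[of b u a] e B_sym C_sym B_not_C by metis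
    moreover have "\<And>x. R b x \<Longrightarrow> x = y"
      using R_degree[of b y a] e y R_not_C calculation C_sym by metis
    ultimately have "q b y u" using pairing_unique[OF q] e B_sym by blast
    then show ?thesis using e B_irrefl by (auto simp: good_def flip_def)
  qed
  ultimately show "\<exists>a b. flippable {u} q u' a b"
    using e bad unfolding flippable_def by auto
qed

end

section \<open>Bad triangles and clusters\<close>

text \<open>The second colour takes all pairs of vertices that are not consecutive on the closed
  path \<open>a, b, c, d, e\<close>; only the pair \<open>a, e\<close> is left unspecified.\<close>

definition cluster :: "('a \<Rightarrow> 'a \<Rightarrow> bool) \<Rightarrow> ('a \<Rightarrow> 'a \<Rightarrow> bool) \<Rightarrow> 'a \<Rightarrow> 'a \<Rightarrow> 'a \<Rightarrow> 'a \<Rightarrow> 'a \<Rightarrow> bool"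
  where "cluster R B a b c d e \<longleftrightarrow> R a b \<and> R b c \<and> R c d \<and> R d e \<and>
    B a c \<and> B c e \<and> B e b \<and> B b d \<and> B d a"

context coloured_graph
begin

definition is_cluster :: "'a set \<Rightarrow> bool" where
  "is_cluster K \<longleftrightarrow> (\<exists>a b c d e. K = {a, b, c, d, e} \<and>
     (cluster R B a b c d e \<or> cluster B R a b c d e))"

lemma R_saturated: "\<lbrakk>R v a; R v b; a \<noteq> b; edge v y\<rbrakk> \<Longrightarrow> y = a \<or> y = b \<or> B v y"
  using R_degree[of v a b y] unfolding edge_def by blast

lemma B_saturated: "\<lbrakk>B v a; B v b; a \<noteq> b; edge v y\<rbrakk> \<Longrightarrow> y = a \<or> y = b \<or> R v y"
  using B_degree[of v a b y] unfolding edge_def by blast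

lemma R_two: "\<lbrakk>R v a; R v b; a \<noteq> b; R v y\<rbrakk> \<Longrightarrow> y = a \<or> y = b"
  using R_degree[of v a b y] by blast

lemma B_two: "\<lbrakk>B v a; B v b; a \<noteq> b; B v y\<rbrakk> \<Longrightarrow> y = a \<or> y = b"
  using B_degree[of v a b y] by blast

lemma R_neq: "R x y \<Longrightarrow> x \<noteq> y" using R_irrefl by blast
lemma B_neq: "B x y \<Longrightarrow> x \<noteq> y" using B_irrefl by blast

end

text \<open>At the apex \<open>x\<close> both edges are blue, so only \<open>u\<close> and
  \<open>w\<close> can be matched corners. Together with the exchange of colours this covers every
  bad two-coloured triangle without a neutral edge.\<close>

locale bad_triangle = coloured_graph R B C for R B C :: "'a \<Rightarrow> 'a \<Rightarrow> bool" +
  fixes q :: "'a \<Rightarrow> 'a \<Rightarrow> 'a \<Rightarrow> bool" and u w x :: 'a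
  assumes q: "pairing q" and uw: "R u w" and ux: "B u x" and wx: "B w x"
    and bad_u: "\<not> q u w x" and bad_w: "\<not> q w u x"
begin

lemma mirror: "bad_triangle R B C q w u x"
  using q R_sym[OF uw] ux wx bad_u bad_w by unfold_locales auto

lemma distinct_triangle: "u \<noteq> w" "u \<noteq> x" "w \<noteq> x" "w \<noteq> u" "x \<noteq> u" "x \<noteq> w"
  using R_neq[OF uw] B_neq[OF ux] B_neq[OF wx] by auto

lemma wu: "R w u" and xu: "B x u" and xw: "B x w"
  using R_sym[OF uw] B_sym[OF ux] B_sym[OF wx] by auto

lemma x_edge: "edge x y \<Longrightarrow> y = u \<or> y = w \<or> R x y"
  using B_saturated[OF xu xw] distinct_triangle by blast

lemma x_blue: "B x y \<Longrightarrow> y = u \<or> y = w"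
  using B_two[OF xu xw] distinct_triangle by blast

lemma q_u_other: "B u y \<Longrightarrow> y \<noteq> x \<Longrightarrow> q u w y"
  using pairing_B[OF q uw ux] bad_u by blast

lemma q_w_other: "B w y \<Longrightarrow> y \<noteq> x \<Longrightarrow> q w u y"
  using pairing_B[OF q wu wx] bad_w by blast

lemma good_if_flip_u: "u \<in> F \<Longrightarrow> good (flip F q) u w x"
  using uw ux bad_u by (simp add: good_def flip_def)

lemma good_if_flip_w: "w \<in> F \<Longrightarrow> good (flip F q) u w x"
  using wu wx bad_w by (simp add: good_def flip_def)

text \<open>
  The bad triangle becomes good by flipping \<open>u\<close>, unless this spoils another triangle that is good at
  \<open>u\<close> only. Such an obstruction is either \<open>{u, w, x'}\<close> with \<open>w x'\<close> red and \<open>u x'\<close> blue (at the side),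
  or \<open>{u, u', x}\<close> with \<open>u u'\<close> and \<open>x u'\<close> red (at the apex). In the remaining cases flipping \<open>u\<close> and
  flipping \<open>w\<close> are both obstructed, each at the side or at the apex.
\<close>

lemma improvable_flip_u:
  assumes A: "\<And>x'. B u x' \<Longrightarrow> R w x' \<Longrightarrow> q x' w u"
    and C: "\<And>u'. R u u' \<Longrightarrow> R x u' \<Longrightarrow> q x u' u"
  shows "improvable q u w x"
proof (rule improvableI[OF q])
  let ?F = "{u}"
  show "good (flip ?F q) u w x" by (rule good_if_flip_u) simp
  have "flippable ?F q u w x"
  proof (rule flippableI, fact uw, fact ux, fact bad_u)
    fix y assume y: "B u y" "y \<noteq> x" "edge w y"
    consider "R w y" | "B w y" | "C w y" using y unfolding edge_def by blast
    then show "good (flip ?F q) u w y"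
    proof cases
      case 1
      then show ?thesis using A[of y] y B_neq[of u y] by (simp add: good_def flip_def)
    next
      case 2
      then show ?thesis using q_w_other[of y] y distinct_triangle by (simp add: good_def flip_def)
    next
      case 3
      \<comment> \<open>The neutral edge \<open>wy\<close> leaves \<open>w\<close> with one red and
        one blue edge, and these would be matched, against \<open>bad_w\<close>.\<close>
      have "q w u x"
      proof (rule pairing_unique[OF q wu wx])
        show "a = u" if "R w a" for a using that 3 R_degree[of w u y a] wu R_not_C by blast
        show "a = x" if "B w a" for a using that 3 B_degree[of w x y a] wx B_not_C by blast
      qed
      then show ?thesis using bad_w by simp
    qed
  next
    fix y assume y: "R u y" "y \<noteq> w" "edge y x"
    then have "R x y" using x_edge[of y] edge_sym R_neq by blast
    then show "good (flip ?F q) u y x"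
      using C[of y] y distinct_triangle by (simp add: good_def flip_def)
  qed
  then show "\<exists>a b. flippable ?F q v a b" if "v \<in> ?F" for v using that by blast
qed

text \<open>Flipping \<open>u\<close> spoils \<open>{u, u', x}\<close>; flipping \<open>x\<close> as
  well makes it good at \<open>x\<close>. The flip at \<open>x\<close> in turn endangers
  \<open>{x, u', w}\<close>, which the last hypothesis keeps good at \<open>u'\<close>, and
  \<open>{x, w', u}\<close>, which would need a blue edge \<open>uw'\<close>.\<close>

lemma apex_apex_flip_xu:
  assumes u': "R u u'" "R x u'" "u' \<noteq> w" "\<not> q x u' u"
    and w': "R w w'" "R x w'" "w' \<noteq> u"
    and "\<not> B u w'" and wu': "B w u' \<Longrightarrow> q u' x w"
  shows "improvable q u w x"
proof (rule improvableI[OF q])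
  let ?F = "{x, u}"
  show "good (flip ?F q) u w x" by (rule good_if_flip_u) simp
  have neq: "u' \<noteq> w'" using R_triangle_free uw u' w' by blast
  have "flippable ?F q u w x"
  proof (rule flippableI, fact uw, fact ux, fact bad_u)
    fix y assume y: "B u y" "y \<noteq> x" "edge w y"
    then have "B w y" using R_saturated[OF wu w'(1)] w' assms(8) B_neq by blast
    then show "good (flip ?F q) u w y"
      using q_w_other[of y] y distinct_triangle by (simp add: good_def flip_def)
  next
    fix y assume y: "R u y" "y \<noteq> w" "edge y x"
    then have "y = u'" using R_two[OF uw u'(1)] u' by blast
    then show "good (flip ?F q) u y x" using u' xu by (simp add: good_def flip_def)
  qed
  moreover have "flippable ?F q x u' u"
  proof (rule flippableI, fact u'(2), fact xu, fact u'(4))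
    fix y assume y: "B x y" "y \<noteq> u" "edge u' y"
    then have "y = w" using x_blue by blast
    then have "B u' w" using y R_saturated[OF R_sym[OF u'(1)] R_sym[OF u'(2)]]
      distinct_triangle by blast
    then show "good (flip ?F q) x u' y"
      using wu'[OF B_sym] \<open>y = w\<close> R_neq[OF u'(1)] R_neq[OF u'(2)] by (simp add: good_def flip_def)
  next
    fix y assume y: "R x y" "y \<noteq> u'" "edge y u"
    then have "y = w'" using R_two[OF u'(2) w'(2)] neq by blast
    then have "B u w'"
      using edge_sym[OF y(3)] R_saturated[OF uw u'(1)] u' neq R_neq[OF w'(1)] by blast
    then show "good (flip ?F q) x y u" using assms(8) by blast
  qed
  ultimately show "\<exists>a b. flippable ?F q v a b" if "v \<in> ?F" for v using that by blast
qed

text \<open>A chain of repairs: the flip at \<open>w\<close> spoils \<open>{w, w', x}\<close>,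
  repaired at \<open>x\<close>; this spoils \<open>{x, w', u}\<close>, repaired at
  \<open>w'\<close>; this endangers \<open>{w', w, u}\<close>, which stays good at the unflipped
  vertex \<open>u\<close>.\<close>

lemma apex_apex_flip_xww':
  assumes u': "R u u'" "R x u'" "u' \<noteq> w"
    and w': "R w w'" "R x w'" "w' \<noteq> u" "\<not> q x w' w"
    and uw': "B u w'" "\<not> q w' x u" and no: "\<not> B w u'" "\<not> B w' u'"
  shows "improvable q u w x"
proof (rule improvableI[OF q])
  let ?F = "{x, w, w'}"
  show "good (flip ?F q) u w x" by (rule good_if_flip_w) simp
  have neq: "u' \<noteq> w'" using R_triangle_free uw u' w' by blast
  have "flippable ?F q w u x"
  proof (rule flippableI, fact wu, fact wx, fact bad_w)
    fix y assume y: "B w y" "y \<noteq> x" "edge u y"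
    then have "B u y" using R_saturated[OF uw u'(1)] u' no B_neq by blast
    then show "good (flip ?F q) w u y"
      using q_u_other[of y] y distinct_triangle w'(3) by (simp add: good_def flip_def)
  next
    fix y assume y: "R w y" "y \<noteq> u" "edge y x"
    then have "y = w'" using R_two[OF wu w'(1)] w' by blast
    then show "good (flip ?F q) w y x" using w' xw by (simp add: good_def flip_def)
  qed
  moreover have "flippable ?F q x w' w"
  proof (rule flippableI, fact w'(2), fact xw, fact w'(4))
    fix y assume y: "B x y" "y \<noteq> w" "edge w' y"
    then have "y = u" using x_blue by blast
    then show "good (flip ?F q) x w' y"
      using uw' B_sym[OF uw'(1)] R_sym[OF w'(2)] by (simp add: good_def flip_def)
  next
    fix y assume y: "R x y" "y \<noteq> w'" "edge y w"
    then have "y = u'" using R_two[OF u'(2) w'(2)] neq by blast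
    then have "B w u'"
      using edge_sym[OF y(3)] R_saturated[OF wu w'(1)] neq R_neq[OF u'(1)] w'(3) by blast
    then show "good (flip ?F q) x y w" using no by blast
  qed
  moreover have "flippable ?F q w' x u"
  proof (rule flippableI, fact R_sym[OF w'(2)], fact B_sym[OF uw'(1)], fact uw'(2))
    fix y assume y: "B w' y" "y \<noteq> u" "edge x y"
    then have "R x y" using x_edge R_not_B[OF R_sym[OF w'(1)]] by blast
    then have "y = u'" using R_two[OF u'(2) w'(2)] neq B_neq y by blast
    then show "good (flip ?F q) w' x y" using no y by blast
  next
    fix y assume y: "R w' y" "y \<noteq> x" "edge y u"
    then have "y = w" using R_two[OF R_sym[OF w'(1)] R_sym[OF w'(2)]] distinct_triangle by blast
    then show "good (flip ?F q) w' y u"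
      using q_u_other[OF uw'(1)] R_neq[OF w'(2)] distinct_triangle w'(3)
      by (simp add: good_def flip_def)
  qed
  ultimately show "\<exists>a b. flippable ?F q v a b" if "v \<in> ?F" for v using that by blast
qed

text \<open>Flipping \<open>u\<close> spoils \<open>{u, w, w'}\<close>, which flipping
  \<open>w'\<close> repairs. The flip at \<open>w'\<close> endangers \<open>{w', u', u}\<close>,
  good at \<open>u\<close> after the flip, and \<open>{w', x, u}\<close>, good at \<open>x\<close>
  by hypothesis.\<close>

lemma side_side_flip_uw':
  assumes u': "R u u'" "B w u'" and w': "R w w'" "B u w'" "\<not> q w' w u"
    and no: "\<not> B w' u'" and x: "R x u' \<Longrightarrow> q x u' u" "R x w' \<Longrightarrow> q x w' u"
  shows "improvable q u w x"
proof (rule improvableI[OF q])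
  let ?F = "{u, w'}"
  show "good (flip ?F q) u w x" by (rule good_if_flip_u) simp
  have neq: "w' \<noteq> u" "w' \<noteq> x" "u' \<noteq> w" "u' \<noteq> x" "w' \<noteq> w"
    using B_neq[OF w'(2)] R_not_B[OF w'(1)] wx B_neq[OF u'(2)] R_not_B[OF u'(1)] ux R_neq[OF w'(1)]
      R_neq[OF u'(1)] by auto
  have "flippable ?F q u w x"
  proof (rule flippableI, fact uw, fact ux, fact bad_u)
    fix y assume y: "B u y" "y \<noteq> x" "edge w y"
    then have "y = w'" using B_two[OF ux w'(2)] neq by blast
    then show "good (flip ?F q) u w y"
      using w' R_sym[OF w'(1)] B_sym[OF w'(2)] by (simp add: good_def flip_def)
  next
    fix y assume y: "R u y" "y \<noteq> w" "edge y x"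
    then have [simp]: "y = u'" using R_two[OF uw u'(1)] neq by blast
    have "R x u'" using x_edge[OF edge_sym[OF y(3)]] R_neq[OF u'(1)] neq by auto
    then show "good (flip ?F q) u y x"
      using x neq distinct_triangle by (simp add: good_def flip_def)
  qed
  moreover have "flippable ?F q w' w u"
  proof (rule flippableI, fact R_sym[OF w'(1)], fact B_sym[OF w'(2)], fact w'(3))
    fix y assume y: "B w' y" "y \<noteq> u" "edge w y"
    then have "B w y" using R_saturated[OF wu w'(1)] neq B_neq by blast
    then have "y = x" using B_two[OF wx u'(2)] neq no y by blast
    then show "good (flip ?F q) w' w y" using y x_blue[OF B_sym, of w'] neq by blast
  next
    fix y assume y: "R w' y" "y \<noteq> w" "edge y u"
    have "y = u' \<or> y = x"
      using R_saturated[OF uw u'(1), of y] B_two[OF ux w'(2), of y] neq edge_sym[OF y(3)] y R_neq by blast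
    moreover have "q u u' x" using pairing_R[OF q uw u'(1) _ ux] neq bad_u by blast
    then have "\<not> q u u' w'" using pairing_B[OF q u'(1) ux w'(2)] neq by blast
    ultimately show "good (flip ?F q) w' y u"
      using x(2) y R_sym[OF y(1)] u' w' neq distinct_triangle by (auto simp: good_def flip_def)
  qed
  ultimately show "\<exists>a b. flippable ?F q v a b" if "v \<in> ?F" for v using that by blast
qed

text \<open>With \<open>w'u'\<close> blue, flipping \<open>w'\<close> also endangers
  \<open>{w', w, u'}\<close>, which becomes good at \<open>w\<close> if \<open>w\<close> is flipped
  too. So all four vertices are flipped together; \<open>mirror\<close> supplies the same facts for
  \<open>w\<close> and \<open>u'\<close>.\<close>

lemma side_side_flippable:
  assumes u': "R u u'" "B w u'" "\<not> q u' u w" and w': "R w w'" "B u w'" "\<not> q w' w u"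
    and blue: "B w' u'" and no: "\<not> R x u'" "\<not> R x w'"
  shows "flippable {u, w, u', w'} q u w x" and "flippable {u, w, u', w'} q w' w u"
proof -
  let ?F = "{u, w, u', w'}"
  have neq: "w' \<noteq> u" "w' \<noteq> x" "u' \<noteq> w" "u' \<noteq> x" "w' \<noteq> w" "u \<noteq> u'"
    using B_neq[OF w'(2)] R_not_B[OF w'(1)] wx B_neq[OF u'(2)] R_not_B[OF u'(1)] ux R_neq[OF w'(1)]
      R_neq[OF u'(1)] by auto
  show "flippable ?F q u w x"
  proof (rule flippableI, fact uw, fact ux, fact bad_u)
    fix y assume y: "B u y" "y \<noteq> x" "edge w y"
    then have "y = w'" using B_two[OF ux w'(2)] neq by blast
    then show "good (flip ?F q) u w y"
      using w' R_sym[OF w'(1)] B_sym[OF w'(2)] by (simp add: good_def flip_def)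
  next
    fix y assume y: "R u y" "y \<noteq> w" "edge y x"
    then have [simp]: "y = u'" using R_two[OF uw u'(1)] neq by blast
    have "R x u'" using x_edge[OF edge_sym[OF y(3)]] R_neq[OF u'(1)] neq by auto
    then show "good (flip ?F q) u y x" using no by blast
  qed
  show "flippable ?F q w' w u"
  proof (rule flippableI, fact R_sym[OF w'(1)], fact B_sym[OF w'(2)], fact w'(3))
    fix y assume y: "B w' y" "y \<noteq> u" "edge w y"
    then have "y = u'" using B_two[OF blue B_sym[OF w'(2)]] neq by blast
    moreover have "q w w' x" using pairing_R[OF q wu w'(1) _ wx] neq bad_w by blast
    then have "\<not> q w w' u'" using pairing_B[OF q w'(1) wx u'(2)] neq by blast
    ultimately show "good (flip ?F q) w' w y"
      using w' u' by (simp add: good_def flip_def)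
  next
    fix y assume y: "R w' y" "y \<noteq> w" "edge y u"
    have "y = u' \<or> y = x"
      using R_saturated[OF uw u'(1), of y] B_two[OF ux w'(2), of y] neq edge_sym[OF y(3)] y R_neq by blast
    then show "good (flip ?F q) w' y u" using no y R_sym[OF y(1)] R_not_B[OF y(1)] blue by blast
  qed
qed

text \<open>Here one vertex \<open>w'\<close> obstructs both flips, at the side for \<open>u\<close>
  and at the apex for \<open>w\<close>. Flipping \<open>w'\<close> repairs
  \<open>{u, w, w'}\<close>, and \<open>{w', x, u}\<close> stays good at \<open>x\<close>, where
  \<open>w'\<close> is matched to \<open>u\<close> because it is not matched to
  \<open>w\<close>.\<close>

lemma side_apex_flip_uw':
  assumes w': "R w w'" "R x w'" "B u w'" "\<not> q w' w u" "\<not> q x w' w"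
    and C: "\<And>u'. R u u' \<Longrightarrow> u' \<noteq> w \<Longrightarrow> R x u' \<Longrightarrow> q x u' u"
    and no: "\<And>z. B w z \<Longrightarrow> B w' z \<Longrightarrow> z = x"
  shows "improvable q u w x"
proof (rule improvableI[OF q])
  let ?F = "{u, w'}"
  show "good (flip ?F q) u w x" by (rule good_if_flip_u) simp
  have neq: "w' \<noteq> u" "w' \<noteq> x" "w' \<noteq> w"
    using B_neq[OF w'(3)] R_neq[OF w'(2)] R_neq[OF w'(1)] by auto
  have "flippable ?F q u w x"
  proof (rule flippableI, fact uw, fact ux, fact bad_u)
    fix y assume y: "B u y" "y \<noteq> x" "edge w y"
    then have "y = w'" using B_two[OF ux w'(3)] neq by blast
    then show "good (flip ?F q) u w y"
      using w' R_sym[OF w'(1)] B_sym[OF w'(3)] by (simp add: good_def flip_def)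
  next
    fix y assume y: "R u y" "y \<noteq> w" "edge y x"
    then have "R x y" using x_edge[OF edge_sym[OF y(3)]] R_neq by blast
    then show "good (flip ?F q) u y x"
      using C[of y] y neq distinct_triangle by (simp add: good_def flip_def)
  qed
  moreover have "flippable ?F q w' w u"
  proof (rule flippableI, fact R_sym[OF w'(1)], fact B_sym[OF w'(3)], fact w'(4))
    fix y assume y: "B w' y" "y \<noteq> u" "edge w y"
    then have "B w y" using R_saturated[OF wu w'(1)] neq B_neq by blast
    then have "y = x" using no y by blast
    then show "good (flip ?F q) w' w y" using y x_blue[OF B_sym, of w'] neq by blast
  next
    fix y assume y: "R w' y" "y \<noteq> w" "edge y u"
    then have "y = x" using R_two[OF R_sym[OF w'(1)] R_sym[OF w'(2)]] distinct_triangle by blast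
    moreover have "q x w' u" using pairing_B[OF q w'(2) xu xw] w' distinct_triangle by blast
    ultimately show "good (flip ?F q) w' y u"
      using neq distinct_triangle by (simp add: good_def flip_def)
  qed
  ultimately show "\<exists>a b. flippable ?F q v a b" if "v \<in> ?F" for v using that by blast
qed

text \<open>Flipping \<open>x\<close> repairs \<open>{w, w', x}\<close>, and
  \<open>{x, w', u}\<close> stays good at \<open>w'\<close>. Since \<open>z\<close> fills the second
  blue slot of \<open>w\<close>, the two missing red edges at \<open>z\<close> exclude all other
  triangles at risk.\<close>

lemma side_apex_flip_wx:
  assumes w': "R w w'" "R x w'" "B u w'" "\<not> q w' w u" "\<not> q x w' w"
    and z: "B w z" "B w' z" "z \<noteq> x" "\<not> R u z" "\<not> R x z"
  shows "improvable q u w x"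
proof (rule improvableI[OF q])
  let ?F = "{w, x}"
  show "good (flip ?F q) u w x" by (rule good_if_flip_w) simp
  have neq: "w' \<noteq> u" "w' \<noteq> x" "w' \<noteq> w" "z \<noteq> w'"
    using B_neq[OF w'(3)] R_neq[OF w'(2)] R_neq[OF w'(1)] B_neq[OF z(2)] by auto
  have "flippable ?F q w u x"
  proof (rule flippableI, fact wu, fact wx, fact bad_w)
    fix y assume y: "B w y" "y \<noteq> x" "edge u y"
    then have "y = z" using B_two[OF wx z(1)] z by blast
    then show "good (flip ?F q) w u y"
      using y z B_saturated[OF ux w'(3), of z] neq by blast
  next
    fix y assume y: "R w y" "y \<noteq> u" "edge y x"
    then have "y = w'" using R_two[OF wu w'(1)] neq by blast
    then show "good (flip ?F q) w y x" using w' xw by (simp add: good_def flip_def)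
  qed
  moreover have "flippable ?F q x w' w"
  proof (rule flippableI, fact w'(2), fact xw, fact w'(5))
    fix y assume y: "B x y" "y \<noteq> w" "edge w' y"
    then have "y = u" using x_blue by blast
    moreover have "q w' x u"
      using pairing_R[OF q R_sym[OF w'(1)] R_sym[OF w'(2)] _ B_sym[OF w'(3)]] w' distinct_triangle by blast
    ultimately show "good (flip ?F q) x w' y"
      using neq distinct_triangle by (simp add: good_def flip_def)
  next
    fix y assume y: "R x y" "y \<noteq> w'" "edge y w"
    have "y = u \<or> y = x \<or> y = z"
      using R_saturated[OF wu w'(1), of y] B_two[OF wx z(1), of y] neq z edge_sym[OF y(3)] y by blast
    then show "good (flip ?F q) x y w" using y z R_neq[of x y] R_not_B[OF y(1)] xu by blast
  qed
  ultimately show "\<exists>a b. flippable ?F q v a b" if "v \<in> ?F" for v using that by blast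
qed

end

section \<open>Case analysis of the obstructions\<close>

context coloured_graph
begin

lemma improvable_swap: "improvable q u v w \<longleftrightarrow> improvable q v u w"
  unfolding improvable_def using good_swap[of _ u v w] by simp

lemma improvable_rotate: "improvable q u v w \<longleftrightarrow> improvable q v w u"
  unfolding improvable_def using good_rotate[of _ u v w] by simp

definition in_cluster :: "'a \<Rightarrow> 'a \<Rightarrow> 'a \<Rightarrow> bool" where
  "in_cluster u v w \<longleftrightarrow> (\<exists>K. is_cluster K \<and> {u, v, w} \<subseteq> K)"

lemma in_clusterI:
  assumes "cluster R B a b c d e \<or> cluster B R a b c d e" "{u, v, w} \<subseteq> {a, b, c, d, e}"
  shows "in_cluster u v w"
  using assms unfolding in_cluster_def is_cluster_def by blast

end

context bad_triangle
begin

text \<open>If \<open>uw'\<close> is not blue, \<open>x\<close> and \<open>u\<close> are flipped. If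
  \<open>uw'\<close> and \<open>w'u'\<close> are both blue, there is a cluster with blue path
  \<open>u', w', u, x, w\<close>. Otherwise the matching at \<open>w'\<close> decides between
  flipping \<open>x, w\<close> and flipping \<open>x, w, w'\<close>.\<close>

lemma apex_apex_half:
  assumes u': "R u u'" "R x u'" "u' \<noteq> w" "\<not> q x u' u"
    and w': "R w w'" "R x w'" "w' \<noteq> u" "\<not> q x w' w" and no: "\<not> B w u'"
  shows "improvable q u w x \<or> in_cluster u w x"
proof -
  consider "\<not> B u w'" | "B u w'" "B w' u'" | "B u w'" "\<not> B w' u'" "q w' x u"
    | "B u w'" "\<not> B w' u'" "\<not> q w' x u" by blast
  then show ?thesis
  proof cases
    case 1
    then show ?thesis using apex_apex_flip_xu[OF u' w'(1-3)] no by blast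
  next
    case 2
    have "cluster B R u' w' u x w"
      unfolding cluster_def
      using 2 B_sym[of u w'] B_sym[of w' u'] ux xw uw u' w' R_sym[of u u'] R_sym[of x w'] by simp
    then show ?thesis using in_clusterI[of u' w' u x w u w x] by simp
  next
    case 3
    then have "improvable q w u x"
      using bad_triangle.apex_apex_flip_xu[OF mirror w' u'(1-3) no] by blast
    then show ?thesis using improvable_swap by blast
  next
    case 4
    then show ?thesis using apex_apex_flip_xww'[OF u'(1-3) w'] no by blast
  qed
qed

lemma apex_apex:
  assumes u': "R u u'" "R x u'" "u' \<noteq> w" "\<not> q x u' u"
    and w': "R w w'" "R x w'" "w' \<noteq> u" "\<not> q x w' w"
  shows "improvable q u w x \<or> in_cluster u w x"
proof -
  consider "\<not> B w u'" | "\<not> B u w'" | "B w u'" "B u w'" by blast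
  then show ?thesis
  proof cases
    case 1
    then show ?thesis using apex_apex_half[OF u' w'] by blast
  next
    case 2
    then have "improvable q w u x \<or> in_cluster w u x"
      using bad_triangle.apex_apex_half[OF mirror w' u'] by blast
    then show ?thesis using improvable_swap[of q w u x] unfolding in_cluster_def by auto
  next
    case 3
    have "cluster B R u' w x u w'"
      unfolding cluster_def
      using 3 B_sym[of w u'] wx xu wu u' w' R_sym[of u u'] R_sym[of x u'] R_sym[of w w'] by simp
    then show ?thesis using in_clusterI[of u' w x u w' u w x] by simp
  qed
qed

text \<open>Any two of red \<open>xu'\<close>, red \<open>xw'\<close> and blue \<open>w'u'\<close>
  complete a cluster. If only \<open>w'u'\<close> is present, four vertices are flipped. In the
  remaining cases the matching at \<open>x\<close> tells whether to flip \<open>u, w'\<close> or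
  \<open>w, u'\<close>.\<close>

lemma side_side:
  assumes u': "R u u'" "B w u'" "\<not> q u' u w" and w': "R w w'" "B u w'" "\<not> q w' w u"
  shows "improvable q u w x \<or> in_cluster u w x"
proof -
  have xR: "q x y u \<longleftrightarrow> \<not> q x y w" if "R x y" for y
    using pairing_B[OF q that xu xw] distinct_triangle by blast
  note syms = R_sym[of u u'] R_sym[of w w'] B_sym[of w u'] B_sym[of u w'] B_sym[of w' u']
    R_sym[of x u'] R_sym[of x w'] uw wu ux xu wx xw
  consider "R x u'" "R x w'" | "B w' u'" "R x u'" | "B w' u'" "R x w'"
    | "B w' u'" "\<not> R x u'" "\<not> R x w'"
    | "\<not> B w' u'" "\<not> R x u' \<or> \<not> R x w'" "R x u' \<longrightarrow> q x u' u" "R x w' \<longrightarrow> q x w' u"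
    | "\<not> B w' u'" "\<not> R x u' \<or> \<not> R x w'" "R x u' \<longrightarrow> q x u' w" "R x w' \<longrightarrow> q x w' w"
    using xR by blast
  then show ?thesis
  proof cases
    case 1
    have "cluster B R w' u x w u'" unfolding cluster_def using 1 syms u' w' by simp
    then show ?thesis using in_clusterI[of w' u x w u' u w x] by simp
  next
    case 2
    have "cluster R B x u' u w w'" unfolding cluster_def using 2 syms u' w' by simp
    then show ?thesis using in_clusterI[of x u' u w w' u w x] by simp
  next
    case 3
    have "cluster R B x w' w u u'" unfolding cluster_def using 3 syms u' w' by simp
    then show ?thesis using in_clusterI[of x w' w u u' u w x] by simp
  next
    case 4
    let ?F = "{u, w, u', w'}"
    have F: "{w, u, w', u'} = ?F" by blast
    have "flippable ?F q w u x" "flippable ?F q u' u w"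
      using bad_triangle.side_side_flippable[OF mirror w' u' B_sym[OF 4(1)] 4(3,2)] unfolding F .
    moreover have "flippable ?F q u w x" "flippable ?F q w' w u"
      using side_side_flippable[OF u' w' 4] .
    ultimately have "improvable q u w x"
      using good_if_flip_u[of ?F] by (intro improvableI[OF q, of ?F]) auto
    then show ?thesis ..
  next
    case 5
    then show ?thesis using side_side_flip_uw'[OF u'(1,2) w'] by blast
  next
    case 6
    then have "improvable q w u x"
      using bad_triangle.side_side_flip_uw'[OF mirror w'(1,2) u'] B_sym by blast
    then show ?thesis using improvable_swap by blast
  qed
qed

text \<open>A second common blue neighbour \<open>z\<close> of \<open>w\<close> and
  \<open>w'\<close> decides: without it \<open>u\<close> and \<open>w'\<close> are flipped; with it
  a red edge from \<open>z\<close> to \<open>u\<close> or \<open>x\<close> completes a cluster, and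
  otherwise \<open>w\<close> and \<open>x\<close> are flipped.\<close>

lemma side_apex:
  assumes w': "R w w'" "R x w'" "B u w'" "\<not> q w' w u" "\<not> q x w' w"
    and C: "\<And>u'. R u u' \<Longrightarrow> u' \<noteq> w \<Longrightarrow> R x u' \<Longrightarrow> q x u' u"
  shows "improvable q u w x \<or> in_cluster u w x"
proof (cases "\<exists>z. B w z \<and> B w' z \<and> z \<noteq> x")
  case False
  then show ?thesis using side_apex_flip_uw'[OF w' C] by blast
next
  case True
  then obtain z where z: "B w z" "B w' z" "z \<noteq> x" by blast
  note syms = R_sym[of u z] R_sym[of x w'] B_sym[of w z] B_sym[of u w'] B_sym[of w' z]
    uw wu ux xu wx xw
  consider "R u z" | "R x z" | "\<not> R u z" "\<not> R x z" by blast
  then show ?thesis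
  proof cases
    case 1
    have "cluster R B z u w w' x" unfolding cluster_def using 1 syms z w' by simp
    then show ?thesis using in_clusterI[of z u w w' x u w x] by simp
  next
    case 2
    have "cluster R B u w w' x z" unfolding cluster_def using 2 syms z w' by simp
    then show ?thesis using in_clusterI[of u w w' x z u w x] by simp
  next
    case 3
    then show ?thesis using side_apex_flip_wx[OF w' z] by blast
  qed
qed

text \<open>If one of the flips at \<open>u\<close> and \<open>w\<close> is unobstructed, it
  improves on its own. Otherwise the kinds of the two obstructions select one of the preceding
  cases, up to \<open>mirror\<close>.\<close>

lemma improvable_or_in_cluster: "improvable q u w x \<or> in_cluster u w x"
proof -
  have case_u: "improvable q u w x"
    if "\<nexists>x'. B u x' \<and> R w x' \<and> \<not> q x' w u" "\<nexists>u'. R u u' \<and> R x u' \<and> u' \<noteq> w \<and> \<not> q x u' u"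
  proof (rule improvable_flip_u)
    fix u' assume "R u u'" "R x u'"
    moreover have "u' \<noteq> w" using \<open>R x u'\<close> R_not_B[of x w] xw by blast
    ultimately show "q x u' u" using that by blast
  qed (use that in blast)
  have case_w: "improvable q u w x"
    if "\<nexists>x'. B w x' \<and> R u x' \<and> \<not> q x' u w" "\<nexists>w'. R w w' \<and> R x w' \<and> w' \<noteq> u \<and> \<not> q x w' w"
  proof -
    have "improvable q w u x"
    proof (rule bad_triangle.improvable_flip_u[OF mirror])
      fix w' assume "R w w'" "R x w'"
      moreover have "w' \<noteq> u" using \<open>R x w'\<close> R_not_B[of x u] xu by blast
      ultimately show "q x w' w" using that by blast
    qed (use that in blast)
    then show ?thesis using improvable_swap by blast
  qed
  show ?thesis
  proof (cases "\<exists>u'. R u u' \<and> R x u' \<and> u' \<noteq> w \<and> \<not> q x u' u")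
    case True
    then obtain u' where u': "R u u'" "R x u'" "u' \<noteq> w" "\<not> q x u' u" by blast
    show ?thesis
    proof (cases "\<exists>w'. R w w' \<and> R x w' \<and> w' \<noteq> u \<and> \<not> q x w' w")
      case True
      then show ?thesis using apex_apex[OF u'] by blast
    next
      case no: False
      show ?thesis
      proof (cases "\<exists>x'. B w x' \<and> R u x' \<and> \<not> q x' u w")
        case True
        then obtain x' where x': "B w x'" "R u x'" "\<not> q x' u w" by blast
        \<comment> \<open>Besides \<open>w\<close>, the vertex \<open>u\<close> has just one red
          neighbour, so the side and the apex obstruction come from the same vertex.\<close>
        have "x' = u'" using R_two[OF uw u'(1) _ x'(2)] u'(3) B_neq[OF x'(1)] by blast
        then have "improvable q w u x \<or> in_cluster w u x"
          using bad_triangle.side_apex[OF mirror u'(1,2) _ _ u'(4)] x' no by blast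
        then show ?thesis using improvable_swap[of q w u x] unfolding in_cluster_def by auto
      next
        case False
        then show ?thesis using case_w no by blast
      qed
    qed
  next
    case no: False
    show ?thesis
    proof (cases "\<exists>x'. B u x' \<and> R w x' \<and> \<not> q x' w u")
      case False
      then show ?thesis using case_u no by blast
    next
      case True
      then obtain w' where w': "B u w'" "R w w'" "\<not> q w' w u" by blast
      show ?thesis
      proof (cases "\<exists>x'. B w x' \<and> R u x' \<and> \<not> q x' u w")
        case True
        then show ?thesis using side_side w' by blast
      next
        case noA: False
        show ?thesis
        proof (cases "\<exists>v. R w v \<and> R x v \<and> v \<noteq> u \<and> \<not> q x v w")
          case True
          then obtain v where v: "R w v" "R x v" "v \<noteq> u" "\<not> q x v w" by blast
          have "v = w'" using R_two[OF wu w'(2) _ v(1)] v(3) B_neq[OF w'(1)] by blast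
          then show ?thesis using side_apex[of w'] w' v no by blast
        next
          case False
          then show ?thesis using case_w noA by blast
        qed
      qed
    qed
  qed
qed

end

section \<open>Maximizing the number of good triangles\<close>

text \<open>Consecutive edges of a trail are linked; the classes of the reflexive transitive closure
  will be the edge sets of the trails.\<close>

definition link :: "('a \<Rightarrow> 'a \<Rightarrow> 'a \<Rightarrow> bool) \<Rightarrow> ('a set \<times> 'a set) set" where
  "link q = {({u, x}, {u, y}) | u x y. q u x y \<or> q u y x}"

lemma linkI: "q u x y \<Longrightarrow> ({u, x}, {u, y}) \<in> link q"
  unfolding link_def by blast

lemma link_swap: "link (\<lambda>u x y. q u y x) = link q"
  unfolding link_def by blast

lemma sym_link: "sym (link q)"
  unfolding link_def sym_def by blast

lemma conn_sym: "(e, f) \<in> (link q)\<^sup>* \<Longrightarrow> (f, e) \<in> (link q)\<^sup>*"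
  using sym_rtrancl[OF sym_link] by (rule symD)

section \<open>Exchange of the colours\<close>

context coloured_graph
begin

interpretation sw: coloured_graph B R C
  by (rule swap_colours)

lemma sw_edge: "sw.edge = edge"
  unfolding sw.edge_def edge_def by (auto simp: fun_eq_iff)

text \<open>A matching lists the red neighbour first, so exchanging the colours transposes its
  arguments.\<close>

lemma sw_pairing_at: "sw.pairing_at u (\<lambda>a b. m b a) \<longleftrightarrow> pairing_at u m"
  unfolding sw.pairing_at_def pairing_at_def by meson

lemma sw_is_cluster: "sw.is_cluster = is_cluster"
  unfolding sw.is_cluster_def is_cluster_def by (intro ext) blast

lemma sw_improvable:
  assumes "sw.improvable (\<lambda>u a b. q u b a) u v w"
  shows "improvable q u v w"
proof -
  obtain q' where q': "sw.pairing q'" "good q' u v w"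
    "\<And>x y z. edge y z \<Longrightarrow> q x z y \<Longrightarrow> good q' x y z"
    using assms unfolding sw.improvable_def sw_edge by blast
  let ?p = "\<lambda>u a b. q' u b a"
  have "pairing ?p" using q'(1) sw_pairing_at[of _ "?p _"] by simp
  moreover have "good ?p x y z \<longleftrightarrow> good q' x y z" for x y z
    unfolding good_def by blast
  moreover have "good q' x y z" if "edge y z" "q x y z" for x y z
    using q'(3)[OF edge_sym[OF that(1)] that(2)] unfolding good_def by blast
  ultimately show ?thesis using q'(2) unfolding improvable_def by (intro exI[of _ ?p]) simp
qed

text \<open>The colour of the third edge decides: a blue one gives a bad triangle directly, a red
  one after exchanging the colours, and a neutral one allows the corner itself to be
  flipped.\<close>

lemma corner_improvable_or_in_cluster:
  assumes q: "pairing q" and e: "R u a" "B u b" "edge a b" and bad: "\<not> good q u a b"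
  shows "improvable q u a b \<or> in_cluster u a b"
proof -
  consider "R a b" | "B a b" | "C a b" using e unfolding edge_def by blast
  then show ?thesis
  proof cases
    case 1
    interpret bad_triangle B R C "\<lambda>u a b. q u b a" u b a
      using q e 1 R_sym[of a b] bad by unfold_locales (simp_all add: good_def sw_pairing_at)
    have "improvable q u b a \<or> in_cluster u b a"
      using improvable_or_in_cluster sw_improvable
      unfolding sw.in_cluster_def in_cluster_def sw_is_cluster by blast
    then show ?thesis
      unfolding in_cluster_def by (metis improvable_rotate improvable_swap insert_commute)
  next
    case 2
    interpret bad_triangle R B C q u a b
      using q e 2 bad by unfold_locales (simp_all add: good_def)
    show ?thesis by (rule improvable_or_in_cluster)
  next
    case 3
    then show ?thesis using improvable_unit[OF q e(1,2)] bad by (simp add: good_def)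
  qed
qed

section \<open>Two-coloured triangles\<close>

definition mixed :: "'a \<Rightarrow> 'a \<Rightarrow> 'a \<Rightarrow> bool" where
  "mixed u v w \<longleftrightarrow> edge u v \<and> edge v w \<and> edge w u \<and>
     (R u v \<or> R v w \<or> R w u) \<and> (B u v \<or> B v w \<or> B w u)"

lemma mixed_improvable_or_in_cluster:
  assumes q: "pairing q" and t: "mixed u v w" and bad: "\<not> good q u v w"
  shows "improvable q u v w \<or> in_cluster u v w"
proof -
  let ?P = "\<lambda>u v w. improvable q u v w \<or> in_cluster u v w"
  have rot: "?P u v w \<longleftrightarrow> ?P v w u" for u v w
    using improvable_rotate[of q u v w] unfolding in_cluster_def by (simp add: insert_commute)
  have swp: "?P u v w \<longleftrightarrow> ?P v u w" for u v w
    using improvable_swap[of q u v w] unfolding in_cluster_def by (simp add: insert_commute)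
  have core: "?P x a b" if "R x a" "B x b" "edge a b" "good q x a b = good q u v w" for x a b
    using corner_improvable_or_in_cluster[OF q that(1-3)] that(4) bad by blast
  have g: "good q v w u = good q u v w" "good q w u v = good q u v w" "good q u w v = good q u v w"
    "good q v u w = good q u v w" "good q w v u = good q u v w"
    unfolding good_def by blast+
  have perms: "?P v w u = ?P u v w" "?P w u v = ?P u v w" "?P u w v = ?P u v w"
    "?P v u w = ?P u v w" "?P w v u = ?P u v w"
    using rot swp by metis+
  have e: "edge u v" "edge v w" "edge w u" "edge v u" "edge w v" "edge u w"
    using t edge_sym unfolding mixed_def by blast+
  \<comment> \<open>Any two edges of a triangle meet, so some corner carries a red and a blue
    edge.\<close>
  have "R u v \<and> B u w \<or> R u w \<and> B u v \<or> R v u \<and> B v w \<or>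
      R v w \<and> B v u \<or> R w u \<and> B w v \<or> R w v \<and> B w u"
    using t R_sym B_sym R_not_B unfolding mixed_def by metis
  then show ?thesis using core e g perms by metis
qed

lemma finite_mixed:
  assumes "finite {v. \<exists>w. edge v w}"
  shows "finite {(u, v, w). mixed u v w}"
proof (rule finite_subset)
  let ?V = "{v. \<exists>w. edge v w}"
  show "{(u, v, w). mixed u v w} \<subseteq> ?V \<times> ?V \<times> ?V" unfolding mixed_def by blast
  show "finite (?V \<times> ?V \<times> ?V)" using assms by blast
qed

text \<open>An improvement keeps every good triangle and gains a bad one, which would raise a count
  bounded by the finitely many mixed triples; so a pairing maximizing this count admits
  none.\<close>

lemma pairing_good_outside_clusters:
  assumes fin: "finite {v. \<exists>w. edge v w}"
  shows "\<exists>q. pairing q \<and> (\<forall>u v w. mixed u v w \<longrightarrow> good q u v w \<or> in_cluster u v w)"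
proof -
  let ?G = "\<lambda>q. {(u, v, w). mixed u v w \<and> good q u v w}"
  have finG: "finite (?G q)" for q
    by (rule finite_subset[OF _ finite_mixed[OF fin]]) blast
  have bound: "card (?G q) < Suc (card {(u, v, w). mixed u v w})" for q
    using card_mono[OF finite_mixed[OF fin], of "?G q"] by (auto simp: less_Suc_eq_le)
  obtain q0 where "pairing q0" using pairing_exists by blast
  from ex_has_greatest_nat[of pairing, OF this, of "\<lambda>q. card (?G q)"] bound
  obtain q where q: "pairing q" and max: "\<And>q'. pairing q' \<Longrightarrow> card (?G q') \<le> card (?G q)"
    by blast
  have "good q u v w \<or> in_cluster u v w" if t: "mixed u v w" for u v w
  proof (rule ccontr)
    assume c: "\<not> (good q u v w \<or> in_cluster u v w)"
    then have "improvable q u v w" using mixed_improvable_or_in_cluster[OF q t] by blast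
    then obtain q' where q': "pairing q'" "good q' u v w"
      and keep: "\<And>x y z. edge y z \<Longrightarrow> q x y z \<Longrightarrow> good q' x y z"
      unfolding improvable_def by blast
    have "good q' x y z" if "mixed x y z" "good q x y z" for x y z
    proof -
      have e: "edge x y" "edge y z" "edge z x" "edge y x" "edge z y" "edge x z"
        using that(1) edge_sym unfolding mixed_def by blast+
      from that(2) consider "q x y z" | "q x z y" | "q y x z" | "q y z x" | "q z x y" | "q z y x"
        unfolding good_def by blast
      then show ?thesis using keep[of y z x] keep[of z y x] keep[of x z y] keep[of z x y]
        keep[of x y z] keep[of y x z] e unfolding good_def by cases blast+
    qed
    then have "?G q \<subset> ?G q'" using t q'(2) c by blast
    then have "card (?G q) < card (?G q')" using finG by (rule psubset_card_mono[rotated])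
    then show False using max[OF q'(1)] by simp
  qed
  then show ?thesis using q by blast
qed

end

section \<open>Putting each cluster on one trail\<close>

context coloured_graph
begin

interpretation sw: coloured_graph B R C
  by (rule swap_colours)

lemma cluster_reverse: "cluster R B a b c d e \<Longrightarrow> cluster R B e d c b a"
  unfolding cluster_def by (metis R_sym B_sym)

lemma cluster_distinct:
  assumes "cluster R B a b c d e"
  shows "distinct [a, b, c, d, e]"
proof -
  have "a \<noteq> e" using assms R_not_B[of d e] unfolding cluster_def by blast
  then show ?thesis
    using assms R_neq[of a b] R_neq[of b c] R_neq[of c d] R_neq[of d e]
      B_neq[of a c] B_neq[of c e] B_neq[of e b] B_neq[of b d] B_neq[of d a]
    unfolding cluster_def by auto
qed

text \<open>An inner vertex of the path already has two edges of each colour inside the cluster, so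
  it has no others.\<close>

lemma cluster_inner:
  assumes cl: "cluster R B a b c d e" and v: "v \<in> {b, c, d}" and e: "edge v y"
  shows "y \<in> {a, b, c, d, e}"
proof -
  have dist: "distinct [a, b, c, d, e]" by (rule cluster_distinct[OF cl])
  have R: "R a b" "R b c" "R c d" "R d e" and B: "B a c" "B c e" "B e b" "B b d" "B d a"
    using cl unfolding cluster_def by auto
  consider "v = b" | "v = c" | "v = d" using v by blast
  then show ?thesis
  proof cases
    case 1
    then show ?thesis using R_saturated[OF R_sym[OF R(1)] R(2), of y]
      B_two[OF B_sym[OF B(3)] B(4), of y] dist e by auto
  next
    case 2
    then show ?thesis using R_saturated[OF R_sym[OF R(2)] R(3), of y]
      B_two[OF B_sym[OF B(1)] B(2), of y] dist e by auto
  next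
    case 3
    then show ?thesis using R_saturated[OF R_sym[OF R(3)] R(4), of y]
      B_two[OF B_sym[OF B(4)] B(5), of y] dist e by auto
  qed
qed

lemma edge_irrefl: "\<not> edge x x"
  using R_irrefl B_irrefl C_irrefl unfolding edge_def by blast

text \<open>Two blue edges at \<open>a\<close> stay in the cluster, so an edge leaving it from
  \<open>a\<close> is red and the only one. The third vertex of a triangle through it is then an
  inner vertex, which has no edge to the outside.\<close>

lemma cluster_end:
  assumes cl: "cluster R B a b c d e" and t: "edge a y" "edge y z" "edge a z"
  shows "y \<in> {a, b, c, d, e}"
proof (rule ccontr)
  assume y: "y \<notin> {a, b, c, d, e}"
  have dist: "distinct [a, b, c, d, e]" by (rule cluster_distinct[OF cl])
  have cl': "R a b" "B a c" "B a d" using cl B_sym unfolding cluster_def by blast+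
  have "R a y" using B_saturated[OF cl'(2,3) _ t(1)] y dist by auto
  then have "z \<in> {b, c, d}"
    using B_saturated[OF cl'(2,3) _ t(3)] R_two[OF cl'(1), of y z] y dist t(2) edge_irrefl by auto
  then show False using cluster_inner[OF cl _ edge_sym[OF t(2)]] y by blast
qed

lemma cluster_closed:
  assumes cl: "cluster R B a b c d e" and v: "v \<in> {a, b, c, d, e}"
    and t: "edge v y" "edge y z" "edge v z"
  shows "y \<in> {a, b, c, d, e}"
proof -
  consider "v = a" | "v = e" | "v \<in> {b, c, d}" using v by blast
  then show ?thesis
  proof cases
    case 1
    then show ?thesis using cluster_end[OF cl] t by blast
  next
    case 2
    then show ?thesis using cluster_end[OF cluster_reverse[OF cl]] t by blast
  next
    case 3
    then show ?thesis using cluster_inner[OF cl] t by blast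
  qed
qed

lemma is_cluster_closed:
  assumes K: "is_cluster K" "v \<in> K" and t: "edge v y" "edge y z" "edge v z"
  shows "y \<in> K"
  using K cluster_closed[OF _ _ t]
    coloured_graph.cluster_closed[OF swap_colours, unfolded sw_edge, OF _ _ t]
  unfolding is_cluster_def by blast

text \<open>The triangles \<open>abc\<close>, \<open>bcd\<close>, \<open>cde\<close> overlap and
  cover the cluster, so membership in \<open>K'\<close> spreads from one vertex to all by
  \<open>is_cluster_closed\<close>.\<close>

lemma is_cluster_subset:
  assumes K: "is_cluster K" and K': "is_cluster K'" and v: "v \<in> K" "v \<in> K'"
  shows "K \<subseteq> K'"
proof -
  obtain a b c d e where K_eq: "K = {a, b, c, d, e}"
    and "cluster R B a b c d e \<or> cluster B R a b c d e"
    using K unfolding is_cluster_def by blast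
  then have E: "edge a b" "edge b c" "edge a c" "edge c d" "edge b d" "edge d e" "edge c e"
    unfolding cluster_def edge_def by auto
  note E' = E[THEN edge_sym]
  have "a \<in> K' \<longleftrightarrow> b \<in> K'" "b \<in> K' \<longleftrightarrow> c \<in> K'"
    using is_cluster_closed[OF K'] E E' by blast+
  moreover have "c \<in> K' \<longleftrightarrow> d \<in> K'" "d \<in> K' \<longleftrightarrow> e \<in> K'"
    using is_cluster_closed[OF K'] E E' by blast+
  ultimately show ?thesis using v K_eq by blast
qed

lemma is_cluster_unique: "\<lbrakk>is_cluster K; is_cluster K'; v \<in> K; v \<in> K'\<rbrakk> \<Longrightarrow> K = K'"
  using is_cluster_subset[of K K' v] is_cluster_subset[of K' K v] by blast

text \<open>
  The quantification over \<open>q\<close> makes the property depend on the matchings at the vertices of \<open>K\<close> only.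
\<close>

definition unifies :: "('a \<Rightarrow> 'a \<Rightarrow> 'a \<Rightarrow> bool) \<Rightarrow> 'a set \<Rightarrow> bool" where
  "unifies m K \<longleftrightarrow> (\<forall>v\<in>K. pairing_at v (m v)) \<and>
     (\<forall>q v w y z. (\<forall>x\<in>K. q x = m x) \<longrightarrow> {v, w, y, z} \<subseteq> K \<longrightarrow>
        R v w \<or> B v w \<longrightarrow> R y z \<or> B y z \<longrightarrow> ({v, w}, {y, z}) \<in> (link q)\<^sup>*)"

lemma unifiesI:
  assumes "\<And>v. v \<in> K \<Longrightarrow> pairing_at v (m v)"
    and "\<And>q v w y z. \<lbrakk>\<forall>x\<in>K. q x = m x; {v, w, y, z} \<subseteq> K; R v w \<or> B v w; R y z \<or> B y z\<rbrakk>
      \<Longrightarrow> ({v, w}, {y, z}) \<in> (link q)\<^sup>*"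
  shows "unifies m K"
  unfolding unifies_def using assms by (intro conjI ballI allI impI)

lemma unifies_pairing: "\<lbrakk>unifies m K; v \<in> K\<rbrakk> \<Longrightarrow> pairing_at v (m v)"
  unfolding unifies_def by blast

lemma unifies_conn:
  assumes "unifies m K" "\<And>x. x \<in> K \<Longrightarrow> q x = m x" "{v, w, y, z} \<subseteq> K"
    "R v w \<or> B v w" "R y z \<or> B y z"
  shows "({v, w}, {y, z}) \<in> (link q)\<^sup>*"
proof -
  have "\<forall>x\<in>K. q x = m x" using assms(2) by blast
  then show ?thesis
    using conjunct2[OF assms(1)[unfolded unifies_def], rule_format, of q v w y z] assms(3-5) by blast
qed

lemma cluster_unifies:
  assumes cl: "cluster R B a b c d e"
  shows "\<exists>m. unifies m {a, b, c, d, e}"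
proof -
  let ?K = "{a, b, c, d, e}"
  have dist: "distinct [a, b, c, d, e]" by (rule cluster_distinct[OF cl])
  have R: "R a b" "R b c" "R c d" "R d e" and B: "B a c" "B c e" "B e b" "B b d" "B d a"
    using cl unfolding cluster_def by auto
  note R' = R[THEN R_sym] and B' = B[THEN B_sym]
  \<comment> \<open>With the partners below the trail runs through \<open>eb, ba, ac, cb, bd, dc, ce, ed, da\<close>, and is
    closed by \<open>ae\<close> if that edge is present.\<close>
  define px where "px v = (if v = a then b else if v = b then c else if v = c then d
    else if v = d then e else d)" for v
  define py where "py v = (if v = a then c else if v = b then d else if v = c then e
    else if v = d then a else c)" for v
  define m where "m v = (\<lambda>x y. R v x \<and> B v y \<and> (x = px v \<longleftrightarrow> y = py v))" for v
  have "pairing_at v (m v)" if "v \<in> ?K" for v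
  proof -
    have "R v (px v)" "B v (py v)"
      using that dist R R' B B' unfolding px_def py_def by auto
    then show ?thesis unfolding m_def by (rule pairing_at_through)
  qed
  moreover have "({v, w}, {y, z}) \<in> (link q)\<^sup>*"
    if eq: "\<forall>x\<in>?K. q x = m x" and K: "{v, w, y, z} \<subseteq> ?K"
      and vw: "R v w \<or> B v w" and yz: "R y z \<or> B y z" for q v w y z
  proof -
    have q: "q v x y" if "v \<in> ?K" "R v x" "B v y" "x = px v \<longleftrightarrow> y = py v" for v x y
      using that(2-4) bspec[OF eq that(1)] by (simp add: m_def)
    have p: "px a = b" "px b = c" "px c = d" "px d = e" "px e = d"
      "py a = c" "py b = d" "py c = e" "py d = a" "py e = c"
      using dist by (auto simp: px_def py_def)
    define E where "E = {f. ({a, b}, f) \<in> (link q)\<^sup>*}"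
    have step: "{v, x} \<in> E \<longleftrightarrow> {v, y} \<in> E" if "q v x y" for v x y
      using linkI[of q v x y] symD[OF sym_link linkI[of q v x y]] that
      unfolding E_def by (auto intro: rtrancl_into_rtrancl)
    have "{a, b} \<in> E" by (simp add: E_def)
    moreover have "{a, b} \<in> E \<longleftrightarrow> {a, c} \<in> E"
      using step[of a b c] q[of a b c] R B p dist by auto
    moreover have "{b, c} \<in> E \<longleftrightarrow> {a, c} \<in> E"
      using step[of c b a] q[of c b a] R' B' p dist by (auto simp: insert_commute)
    moreover have "{b, c} \<in> E \<longleftrightarrow> {b, d} \<in> E"
      using step[of b c d] q[of b c d] R B p dist by auto
    moreover have "{c, d} \<in> E \<longleftrightarrow> {b, d} \<in> E"
      using step[of d c b] q[of d c b] R' B' p dist by (auto simp: insert_commute)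
    moreover have "{c, d} \<in> E \<longleftrightarrow> {c, e} \<in> E"
      using step[of c d e] q[of c d e] R B p dist by auto
    moreover have "{d, e} \<in> E \<longleftrightarrow> {c, e} \<in> E"
      using step[of e d c] q[of e d c] R' B' p dist by (auto simp: insert_commute)
    moreover have "{d, e} \<in> E \<longleftrightarrow> {a, d} \<in> E"
      using step[of d e a] q[of d e a] R B p dist by (auto simp: insert_commute)
    moreover have "{a, b} \<in> E \<longleftrightarrow> {b, e} \<in> E"
      using step[of b a e] q[of b a e] R' B' p dist by (auto simp: insert_commute)
    \<comment> \<open>At \<open>e\<close> the chosen pair is \<open>d, c\<close>, so the other red
      neighbour \<open>a\<close> is matched to the other blue neighbour \<open>b\<close>. The next
      fact shows that \<open>ae\<close> is not blue.\<close>
    moreover have "R a e \<Longrightarrow> {a, e} \<in> E \<longleftrightarrow> {b, e} \<in> E"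
      using step[of e a b] q[of e a b] R_sym[of a e] B p dist by (auto simp: insert_commute)
    moreover have "\<not> B a e" using B_two[OF B(1) B'(5), of e] dist by auto
    ultimately have all: "{v, w} \<in> E" if "v \<in> ?K" "w \<in> ?K" "R v w \<or> B v w" for v w
      using that R_neq[of v w] B_neq[of v w] R_sym[of v w] B_sym[of v w]
      by (auto simp: insert_commute)
    have "({a, b}, {v, w}) \<in> (link q)\<^sup>*" "({a, b}, {y, z}) \<in> (link q)\<^sup>*"
      using all[of v w] all[of y z] K vw yz unfolding E_def by auto
    then show ?thesis by (blast intro: rtrancl_trans conn_sym)
  qed
  ultimately have "unifies m ?K" by (rule unifiesI)
  then show ?thesis by blast
qed

end

section \<open>One pairing for all clusters\<close>

context coloured_graph
begin

interpretation sw: coloured_graph B R C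
  by (rule swap_colours)

lemma is_cluster_unifies:
  assumes "is_cluster K"
  shows "\<exists>m. unifies m K"
proof -
  obtain a b c d e where K: "K = {a, b, c, d, e}"
    and "cluster R B a b c d e \<or> cluster B R a b c d e"
    using assms unfolding is_cluster_def by blast
  then consider "cluster R B a b c d e" | "cluster B R a b c d e" by blast
  then show ?thesis
  proof cases
    case 1
    then show ?thesis using cluster_unifies K by blast
  next
    case 2
    then obtain m where m: "sw.unifies m K" using sw.cluster_unifies K by blast
    let ?m = "\<lambda>v x y. m v y x"
    have "pairing_at v (?m v)" if "v \<in> K" for v
      using sw.unifies_pairing[OF m that] sw_pairing_at[of v "?m v"] by simp
    moreover have "({v, w}, {y, z}) \<in> (link q)\<^sup>*"
      if "\<forall>x\<in>K. q x = ?m x" "{v, w, y, z} \<subseteq> K" "R v w \<or> B v w" "R y z \<or> B y z" for q v w y z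
    proof -
      have "({v, w}, {y, z}) \<in> (link (\<lambda>u a b. q u b a))\<^sup>*"
      proof (rule sw.unifies_conn[OF m])
        show "(\<lambda>a b. q x b a) = m x" if "x \<in> K" for x
          using bspec[OF \<open>\<forall>x\<in>K. q x = ?m x\<close> that] by simp
      qed (fact that(2) | use that(3,4) in blast)+
      then show ?thesis by (simp only: link_swap[of q])
    qed
    ultimately have "unifies ?m K" by (rule unifiesI)
    then show ?thesis by blast
  qed
qed

text \<open>A mixed triangle lies inside a cluster or avoids all of them. In the first case the
  unifying matchings connect its edges, in the second the pairing is unchanged at its corners and
  the triangle is still good.\<close>

lemma pairing_connecting_mixed_triangles:
  assumes fin: "finite {v. \<exists>w. edge v w}"
  shows "\<exists>q. pairing q \<and> (\<forall>u v w. mixed u v w \<longrightarrow>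
    (\<exists>a b c d. {a, b, c, d} \<subseteq> {u, v, w} \<and> R a b \<and> B c d \<and> ({a, b}, {c, d}) \<in> (link q)\<^sup>*))"
proof -
  obtain q where q: "pairing q"
    and outside: "\<And>u v w. mixed u v w \<Longrightarrow> good q u v w \<or> in_cluster u v w"
    using pairing_good_outside_clusters[OF fin] by blast
  obtain m where m: "\<And>K. is_cluster K \<Longrightarrow> unifies (m K) K"
    using is_cluster_unifies by metis
  \<comment> \<open>Clusters are disjoint, so the description singles out the only cluster
    containing \<open>v\<close>.\<close>
  define p where "p v = (if \<exists>K. is_cluster K \<and> v \<in> K
    then m (THE K. is_cluster K \<and> v \<in> K) v else q v)" for v
  have p_in: "p v = m K v" if "is_cluster K" "v \<in> K" for v K
  proof -
    have "(THE K. is_cluster K \<and> v \<in> K) = K"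
      using that is_cluster_unique by (intro the_equality) blast+
    then show ?thesis using that unfolding p_def by auto
  qed
  have p_out: "p v = q v" if "\<nexists>K. is_cluster K \<and> v \<in> K" for v
    using that unfolding p_def by auto
  have "pairing_at v (p v)" for v
  proof (cases "\<exists>K. is_cluster K \<and> v \<in> K")
    case True
    then show ?thesis using p_in unifies_pairing[OF m] by auto
  next
    case False
    then show ?thesis using p_out q by simp
  qed
  moreover have "\<exists>a b c d. {a, b, c, d} \<subseteq> {u, v, w} \<and> R a b \<and> B c d \<and> ({a, b}, {c, d}) \<in> (link p)\<^sup>*"
    if t: "mixed u v w" for u v w
  proof -
    have e: "edge u v" "edge v w" "edge w u" "edge v u" "edge w v" "edge u w"
      using t edge_sym unfolding mixed_def by blast+
    obtain a b c d where abcd: "{a, b, c, d} \<subseteq> {u, v, w}" "R a b" "B c d"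
      using t unfolding mixed_def by blast
    show ?thesis
    proof (cases "\<exists>K. is_cluster K \<and> K \<inter> {u, v, w} \<noteq> {}")
      case True
      then obtain K where K: "is_cluster K" "K \<inter> {u, v, w} \<noteq> {}" by blast
      then have "{u, v, w} \<subseteq> K" using is_cluster_closed[OF K(1)] e by blast
      then have "{a, b, c, d} \<subseteq> K" using abcd by blast
      then have "({a, b}, {c, d}) \<in> (link p)\<^sup>*"
        using unifies_conn[of "m K" K p a b c d, OF m[OF K(1)] p_in[OF K(1)]] abcd by blast
      then show ?thesis using abcd by blast
    next
      case False
      then have "\<not> in_cluster u v w" unfolding in_cluster_def by blast
      then have "good q u v w" using outside t by blast
      then obtain x y z where xyz: "{x, y, z} \<subseteq> {u, v, w}" "q x y z"
        unfolding good_def by blast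
      then have "p x = q x" using p_out False by blast
      then have "p x y z" using xyz by simp
      have "R x y" "B x z" using pairing_colours[of q x y z] q xyz(2) by blast+
      moreover have "({x, y}, {x, z}) \<in> (link p)\<^sup>*" using linkI[of p x y z] \<open>p x y z\<close> by blast
      ultimately show ?thesis using xyz(1) by (intro exI[of _ x] exI[of _ y] exI[of _ z]) simp
    qed
  qed
  ultimately show ?thesis by blast
qed

end

section \<open>Trails\<close>

lemma length_walk_edges: "length (walk_edges us) = length us - 1"
  by (simp add: walk_edges_def)

lemma walk_edges_nth: "Suc i < length us \<Longrightarrow> walk_edges us ! i = {us ! i, us ! Suc i}"
  by (simp add: walk_edges_def nth_tl)

lemma walk_edges_Cons: "us \<noteq> [] \<Longrightarrow> walk_edges (y # us) = {y, us ! 0} # walk_edges us"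
  by (cases us) (simp_all add: walk_edges_def)

lemma walk_edges_snoc:
  "us \<noteq> [] \<Longrightarrow> walk_edges (us @ [y]) = walk_edges us @ [{us ! (length us - 1), y}]"
proof (induction us)
  case (Cons a us)
  show ?case
  proof (cases us)
    case Nil
    then show ?thesis by (simp add: walk_edges_def)
  next
    case (Cons b vs)
    then have ne: "us \<noteq> []" by simp
    have "walk_edges ((a # us) @ [y]) = {a, us ! 0} # walk_edges (us @ [y])"
      using walk_edges_Cons[of "us @ [y]" a] ne by (simp add: nth_append)
    then show ?thesis using Cons.IH[OF ne] walk_edges_Cons[OF ne, of a] ne by simp
  qed
qed simp

lemma in_walk_edges:
  "e \<in> set (walk_edges us) \<longleftrightarrow> (\<exists>i. Suc i < length us \<and> e = {us ! i, us ! Suc i})"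
proof -
  have "Suc i < length us \<longleftrightarrow> i < length us - 1" for i by linarith
  then show ?thesis unfolding in_set_conv_nth length_walk_edges using walk_edges_nth by metis
qed

section \<open>Classes of linked edges as trails\<close>

context coloured_graph
begin

abbreviation joined where "joined q u x y \<equiv> q u x y \<or> q u y x"

lemma joined_unique:
  assumes "pairing q" "joined q u x y" "joined q u x y'"
  shows "y = y'"
  using assms pairing_colours[OF assms(1)] pairing_R[OF assms(1)] pairing_B[OF assms(1)] R_not_B
  by metis

definition pairing_walk where
  "pairing_walk q us \<longleftrightarrow> 2 \<le> length us \<and> distinct (walk_edges us) \<and>
     (\<forall>i. Suc i < length us \<longrightarrow> R (us ! i) (us ! Suc i) \<or> B (us ! i) (us ! Suc i)) \<and>
     (\<forall>i. Suc (Suc i) < length us \<longrightarrow> joined q (us ! Suc i) (us ! i) (us ! Suc (Suc i)))"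

lemma pairing_walk_snoc:
  assumes q: "pairing q" and us: "pairing_walk q us" and i: "Suc (Suc i) = length us"
    and y: "joined q (us ! Suc i) (us ! i) y" and new: "{us ! Suc i, y} \<notin> set (walk_edges us)"
  shows "pairing_walk q (us @ [y])"
proof -
  have ne: "us \<noteq> []" using i by auto
  have "distinct (walk_edges (us @ [y]))"
    using us new i[symmetric] unfolding walk_edges_snoc[OF ne] pairing_walk_def by simp
  moreover have "R ((us @ [y]) ! j) ((us @ [y]) ! Suc j) \<or> B ((us @ [y]) ! j) ((us @ [y]) ! Suc j)"
    if "Suc j < length (us @ [y])" for j
  proof (cases "Suc j < length us")
    case True
    then show ?thesis using us unfolding pairing_walk_def by (simp add: nth_append)
  next
    case False
    then have "j = Suc i" using that i by simp
    then show ?thesis using y pairing_colours[OF q] i by (auto simp: nth_append)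
  qed
  moreover have "joined q ((us @ [y]) ! Suc j) ((us @ [y]) ! j) ((us @ [y]) ! Suc (Suc j))"
    if "Suc (Suc j) < length (us @ [y])" for j
  proof (cases "Suc (Suc j) < length us")
    case True
    then show ?thesis using us unfolding pairing_walk_def by (simp add: nth_append)
  next
    case False
    then have "j = i" using that i by simp
    then show ?thesis using y i by (auto simp: nth_append)
  qed
  ultimately show ?thesis using i unfolding pairing_walk_def by simp
qed

lemma pairing_walk_Cons:
  assumes q: "pairing q" and us: "pairing_walk q us"
    and y: "joined q (us ! 0) (us ! 1) y" and new: "{us ! 0, y} \<notin> set (walk_edges us)"
  shows "pairing_walk q (y # us)"
proof -
  have len: "2 \<le> length us" using us unfolding pairing_walk_def by blast
  then have ne: "us \<noteq> []" by auto
  have "distinct (walk_edges (y # us))"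
    using us new unfolding walk_edges_Cons[OF ne] pairing_walk_def by (simp add: insert_commute)
  moreover have "R ((y # us) ! j) ((y # us) ! Suc j) \<or> B ((y # us) ! j) ((y # us) ! Suc j)"
    if "Suc j < length (y # us)" for j
  proof (cases j)
    case 0
    then show ?thesis using y pairing_colours[OF q] R_sym B_sym by auto
  next
    case (Suc k)
    then show ?thesis using us that unfolding pairing_walk_def by simp
  qed
  moreover have "joined q ((y # us) ! Suc j) ((y # us) ! j) ((y # us) ! Suc (Suc j))"
    if "Suc (Suc j) < length (y # us)" for j
  proof (cases j)
    case 0
    then show ?thesis using y by auto
  next
    case (Suc k)
    then show ?thesis using us that unfolding pairing_walk_def by simp
  qed
  ultimately show ?thesis using len unfolding pairing_walk_def by simp
qed

text \<open>At an inner vertex the partner of an edge of the walk is the neighbouring edge, by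
  \<open>joined_unique\<close>; at an end a partner outside the walk would extend it, behind or in
  front.\<close>

lemma longest_walk_closed:
  assumes q: "pairing q" and us: "pairing_walk q us"
    and max: "\<And>vs. pairing_walk q vs \<Longrightarrow> set (walk_edges us) \<subseteq> set (walk_edges vs) \<Longrightarrow>
      length vs \<le> length us"
    and e: "e \<in> set (walk_edges us)" and ef: "(e, f) \<in> link q"
  shows "f \<in> set (walk_edges us)"
proof (rule ccontr)
  assume new: "f \<notin> set (walk_edges us)"
  have len: "2 \<le> length us" using us unfolding pairing_walk_def by blast
  then have ne: "us \<noteq> []" by auto
  obtain u x y where uxy: "e = {u, x}" "f = {u, y}" "joined q u x y"
    using ef unfolding link_def by blast
  obtain i where i: "Suc i < length us" "e = {us ! i, us ! Suc i}"
    using e unfolding in_walk_edges by blast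
  then consider "u = us ! Suc i" "x = us ! i" | "u = us ! i" "x = us ! Suc i"
    using uxy(1) by (auto simp: doubleton_eq_iff)
  then show False
  proof cases
    case 1
    show False
    proof (cases "Suc (Suc i) < length us")
      case True
      then have "joined q u x (us ! Suc (Suc i))" using us 1 unfolding pairing_walk_def by blast
      then have "y = us ! Suc (Suc i)" using joined_unique[OF q uxy(3)] by blast
      then show False using new True 1 uxy(2) unfolding in_walk_edges by blast
    next
      case False
      then have n: "Suc (Suc i) = length us" using i by simp
      have "pairing_walk q (us @ [y])"
        using pairing_walk_snoc[OF q us n] uxy 1 new by simp
      then show False using max[of "us @ [y]"] walk_edges_snoc[OF ne] by auto
    qed
  next
    case 2
    show False
    proof (cases i)
      case (Suc k)
      then have "joined q u (us ! k) x" using us 2 i unfolding pairing_walk_def by auto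
      then have "y = us ! k" using joined_unique[OF q uxy(3), of "us ! k"] by blast
      then have "f = {us ! k, us ! Suc k}" using 2 uxy(2) Suc by auto
      moreover have "Suc k < length us" using i Suc by simp
      ultimately show False using new unfolding in_walk_edges by blast
    next
      case 0
      have "pairing_walk q (y # us)"
        using pairing_walk_Cons[OF q us] uxy 2 new 0 by simp
      then show False using max[of "y # us"] walk_edges_Cons[OF ne] by auto
    qed
  qed
qed

lemma walk_edges_connected:
  assumes us: "pairing_walk q us" and e: "e \<in> set (walk_edges us)" and f: "f \<in> set (walk_edges us)"
  shows "(e, f) \<in> (link q)\<^sup>*"
proof -
  have "({us ! 0, us ! Suc 0}, {us ! i, us ! Suc i}) \<in> (link q)\<^sup>*" if "Suc i < length us" for i
    using that
  proof (induction i)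
    case (Suc i)
    then have "joined q (us ! Suc i) (us ! i) (us ! Suc (Suc i))"
      using us unfolding pairing_walk_def by blast
    then have "({us ! Suc i, us ! i}, {us ! Suc i, us ! Suc (Suc i)}) \<in> link q"
      unfolding link_def by blast
    then show ?case using Suc by (simp add: insert_commute rtrancl_into_rtrancl)
  qed simp
  then have "({us ! 0, us ! Suc 0}, e) \<in> (link q)\<^sup>*" "({us ! 0, us ! Suc 0}, f) \<in> (link q)\<^sup>*"
    using e f unfolding in_walk_edges by auto
  then show ?thesis by (blast intro: rtrancl_trans conn_sym)
qed

text \<open>A longest walk through the given edge is closed under \<open>link\<close> and has all
  its edges connected, so its edges form exactly one class.\<close>

lemma class_is_walk:
  assumes fin: "finite {v. \<exists>w. edge v w}" and q: "pairing q" and xy: "R x y \<or> B x y"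
  shows "\<exists>us. pairing_walk q us \<and> set (walk_edges us) = (link q)\<^sup>* `` {{x, y}}"
proof -
  let ?V = "{v. \<exists>w. edge v w}"
  let ?P = "\<lambda>us. pairing_walk q us \<and> {x, y} \<in> set (walk_edges us)"
  \<comment> \<open>The edges of a walk are distinct subsets of \<open>?V\<close>, and a walk has
    one vertex entry more than it has edges.\<close>
  have bound: "length us < Suc (Suc (card (Pow ?V)))" if us: "?P us" for us
  proof -
    have "set (walk_edges us) \<subseteq> Pow ?V"
    proof
      fix e assume "e \<in> set (walk_edges us)"
      then obtain i where i: "Suc i < length us" "e = {us ! i, us ! Suc i}"
        unfolding in_walk_edges by blast
      then have "edge (us ! i) (us ! Suc i)" using us unfolding pairing_walk_def edge_def by blast
      then show "e \<in> Pow ?V" using i edge_sym by blast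
    qed
    then have "card (set (walk_edges us)) \<le> card (Pow ?V)"
      using fin by (intro card_mono) auto
    moreover have "card (set (walk_edges us)) = length us - 1"
      using us distinct_card[of "walk_edges us"] length_walk_edges
      unfolding pairing_walk_def by metis
    ultimately show ?thesis by linarith
  qed
  have "?P [x, y]" using xy by (auto simp: pairing_walk_def walk_edges_def)
  from ex_has_greatest_nat[of ?P, OF this, of length] bound
  obtain us where us: "pairing_walk q us" "{x, y} \<in> set (walk_edges us)"
    and max: "\<And>vs. ?P vs \<Longrightarrow> length vs \<le> length us" by blast
  have closed: "f \<in> set (walk_edges us)" if "e \<in> set (walk_edges us)" "(e, f) \<in> link q" for e f
    using longest_walk_closed[OF q us(1) _ that] max us(2) by blast
  have "f \<in> set (walk_edges us)" if "({x, y}, f) \<in> (link q)\<^sup>*" for f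
    using that by (induction rule: rtrancl_induct) (use us(2) closed in blast)+
  then have "set (walk_edges us) = (link q)\<^sup>* `` {{x, y}}"
    using walk_edges_connected[OF us(1,2)] by auto
  then show ?thesis using us(1) by blast
qed

section \<open>Switching a matching along a class\<close>

definition switched :: "'a set set \<Rightarrow> 'a \<Rightarrow> 'a \<Rightarrow> bool" where
  "switched P x y \<longleftrightarrow> C x y \<or> R x y \<and> {x, y} \<notin> P \<or> B x y \<and> {x, y} \<in> P"

text \<open>Of a matched pair \<open>P\<close> contains both edges or neither, so exactly one of
  them is in the switched set. A maximum matching saturates one colour at \<open>v\<close>;
  replacing edges of this colour by their partners maps the switched edges at \<open>v\<close>
  injectively into one of the given 2-matchings.\<close>

lemma switched_degree:
  assumes q: "pairing q" and P: "\<And>e f. (e, f) \<in> link q \<Longrightarrow> e \<in> P \<longleftrightarrow> f \<in> P"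
    and y: "switched P v y1" "switched P v y2" "switched P v y3"
  shows "y1 = y2 \<or> y1 = y3 \<or> y2 = y3"
proof -
  have P_q: "{v, x} \<in> P \<longleftrightarrow> {v, y} \<in> P" if "q v x y" for x y
    using P linkI[of q v x y] that by blast
  consider "\<forall>y. B v y \<longrightarrow> (\<exists>x. q v x y)" | y0 where "B v y0" "\<nexists>x. q v x y0" by blast
  then show ?thesis
  proof cases
    case 1
    then obtain g where g: "\<And>y. B v y \<Longrightarrow> q v (g y) y" by metis
    define h where "h y = (if B v y then g y else y)" for y
    have "R v (h y) \<or> C v (h y)" if "switched P v y" for y
      using that g pairing_colours[OF q] unfolding switched_def h_def by auto
    moreover have "y = y'" if s: "switched P v y" "switched P v y'" and eq: "h y = h y'" for y y'
    proof (cases "B v y")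
      case vy: True
      have qy: "q v (h y) y" using g[OF vy] vy by (simp add: h_def)
      show ?thesis
      proof (cases "B v y'")
        case True
        then have "q v (h y) y'" using g eq by (simp add: h_def)
        then show ?thesis using joined_unique[OF q] qy by blast
      next
        case False
        then have "q v y' y" using qy eq by (simp add: h_def)
        then show ?thesis
          using s P_q False vy R_not_C B_not_C[OF vy] pairing_colours[OF q] R_not_B
          unfolding switched_def by metis
      qed
    next
      case nby: False
      show ?thesis
      proof (cases "B v y'")
        case True
        then have "q v y y'" using g[OF True] nby eq by (simp add: h_def)
        then show ?thesis
          using s P_q nby True R_not_C B_not_C[OF True] pairing_colours[OF q] R_not_B
          unfolding switched_def by metis
      next
        case False
        then show ?thesis using nby eq by (simp add: h_def)
      qed
    qed
    ultimately show ?thesis using R_degree[of v "h y1" "h y2" "h y3"] y by blast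
  next
    case 2
    \<comment> \<open>Since \<open>y0\<close> is unmatched, \<open>pairing_R\<close> makes
      \<open>x\<close> the only red neighbour. Maximality then forces a second blue edge, and
      \<open>pairing_B\<close> matches \<open>x\<close> to it.\<close>
    have "\<exists>y. q v x y" if x: "R v x" for x
    proof -
      have "\<not> q v x y0" using 2 by blast
      moreover have "a = x" if "R v a" for a using pairing_R[OF q that x _ 2(1)] 2(2) by blast
      ultimately obtain b where "B v b" "b \<noteq> y0" using pairing_unique[OF q x 2(1)] by blast
      then show ?thesis using pairing_B[OF q x 2(1)] 2(2) by blast
    qed
    then obtain g where g: "\<And>x. R v x \<Longrightarrow> q v x (g x)" by metis
    define h where "h y = (if R v y then g y else y)" for y
    have "B v (h y) \<or> C v (h y)" if "switched P v y" for y
      using that g pairing_colours[OF q] unfolding switched_def h_def by auto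
    moreover have "y = y'" if s: "switched P v y" "switched P v y'" and eq: "h y = h y'" for y y'
    proof (cases "R v y")
      case ry: True
      have qy: "q v y (h y)" using g[OF ry] ry by (simp add: h_def)
      show ?thesis
      proof (cases "R v y'")
        case True
        then have "q v y' (h y)" using g eq by (simp add: h_def)
        then show ?thesis using joined_unique[OF q] qy by blast
      next
        case False
        then have "q v y y'" using qy eq by (simp add: h_def)
        then show ?thesis
          using s P_q False ry B_not_C R_not_C[OF ry] pairing_colours[OF q] R_not_B
          unfolding switched_def by metis
      qed
    next
      case nry: False
      show ?thesis
      proof (cases "R v y'")
        case True
        then have "q v y' y" using g[OF True] nry eq by (simp add: h_def)
        then show ?thesis
          using s P_q nry True B_not_C R_not_C[OF True] pairing_colours[OF q] R_not_B
          unfolding switched_def by metis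
      next
        case False
        then show ?thesis using nry eq by (simp add: h_def)
      qed
    qed
    ultimately show ?thesis using B_degree[of v "h y1" "h y2" "h y3"] y by blast
  qed
qed

text \<open>A switched triangle has edges of both colours, since neither matching contains a
  triangle. Some red and some blue edge of it lie in one class, so \<open>P\<close> contains both or
  neither, and one of the two is missing after the switch.\<close>

lemma switched_triangle_free:
  assumes mix: "\<And>u v w. mixed u v w \<Longrightarrow>
      \<exists>a b c d. {a, b, c, d} \<subseteq> {u, v, w} \<and> R a b \<and> B c d \<and> ({a, b}, {c, d}) \<in> (link q)\<^sup>*"
    and P: "\<And>e f. (e, f) \<in> link q \<Longrightarrow> e \<in> P \<longleftrightarrow> f \<in> P"
  shows "\<not> (switched P x y \<and> switched P y z \<and> switched P z x)"
proof
  assume t: "switched P x y \<and> switched P y z \<and> switched P z x"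
  have sw_sym: "switched P b a" if "switched P a b" for a b
    using that R_sym B_sym C_sym unfolding switched_def by (auto simp: insert_commute)
  have "edge x y" "edge y z" "edge z x" using t unfolding switched_def edge_def by blast+
  moreover have "R x y \<or> R y z \<or> R z x"
    using t B_triangle_free[of x y z] B_sym C_sym unfolding switched_def by metis
  moreover have "B x y \<or> B y z \<or> B z x"
    using t R_triangle_free[of x y z] R_sym C_sym unfolding switched_def by metis
  ultimately have t': "mixed x y z" unfolding mixed_def by blast
  obtain a b c d where abcd: "{a, b, c, d} \<subseteq> {x, y, z}" "R a b" "B c d"
    "({a, b}, {c, d}) \<in> (link q)\<^sup>*" using mix[OF t'] by (elim exE conjE)
  have all: "switched P a b" if "a \<in> {x, y, z}" "b \<in> {x, y, z}" "a \<noteq> b" for a b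
    using that t sw_sym[of x y] sw_sym[of y z] sw_sym[of z x] by blast
  have "switched P a b" "switched P c d"
    using abcd(1) all[of a b] all[of c d] R_neq[OF abcd(2)] B_neq[OF abcd(3)] by simp_all
  then have "{a, b} \<notin> P" "{c, d} \<in> P"
    using abcd(2,3) R_not_B[of a b] R_not_C[of a b] R_not_B[of c d] B_not_C[of c d]
    unfolding switched_def by auto
  moreover have "{a, b} \<in> P \<longleftrightarrow> {c, d} \<in> P"
    using abcd(4) by (induction rule: rtrancl_induct) (use P in auto)
  ultimately show False by blast
qed

end

section \<open>From matchings to coloured graphs\<close>

lemma simple_graph_edge:
  assumes "simple_graph V E" "e \<in> E" "v \<in> e"
  shows "\<exists>w. e = {v, w} \<and> v \<noteq> w \<and> v \<in> V \<and> w \<in> V"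
  using assms unfolding simple_graph_def by blast

lemma two_matching_iff:
  assumes G: "simple_graph V E" and M: "M \<subseteq> E"
  shows "two_matching V E M \<longleftrightarrow>
    (\<forall>v y1 y2 y3. {v, y1} \<in> M \<longrightarrow> {v, y2} \<in> M \<longrightarrow> {v, y3} \<in> M \<longrightarrow> y1 = y2 \<or> y1 = y3 \<or> y2 = y3)"
    (is "?L \<longleftrightarrow> ?R")
proof
  assume L: ?L
  show ?R
  proof (intro allI impI)
    fix v y1 y2 y3 assume y: "{v, y1} \<in> M" "{v, y2} \<in> M" "{v, y3} \<in> M"
    have "v \<in> V" using simple_graph_edge[OF G, of "{v, y1}" v] y(1) M by blast
    then have "card {e \<in> M. v \<in> e} \<le> 2" using L unfolding two_matching_def by blast
    \<comment> \<open>An infinite set has cardinality 0, so the bound on \<open>card\<close> has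
      content only through finiteness.\<close>
    moreover have "finite {e \<in> M. v \<in> e}"
    proof (rule finite_subset)
      show "{e \<in> M. v \<in> e} \<subseteq> Pow V" using M G unfolding simple_graph_def by blast
      show "finite (Pow V)" using G unfolding simple_graph_def by simp
    qed
    ultimately have "card {{v, y1}, {v, y2}, {v, y3}} \<le> 2"
      using card_mono[of "{e \<in> M. v \<in> e}" "{{v, y1}, {v, y2}, {v, y3}}"] y by simp
    then show "y1 = y2 \<or> y1 = y3 \<or> y2 = y3"
      by (auto simp: card_insert_if doubleton_eq_iff split: if_splits)
  qed
next
  assume R: ?R
  show ?L unfolding two_matching_def
  proof (intro conjI M ballI)
    fix v
    show "card {e \<in> M. v \<in> e} \<le> 2"
    proof (rule ccontr)
      assume "\<not> card {e \<in> M. v \<in> e} \<le> 2"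
      then have "3 \<le> card {e \<in> M. v \<in> e}" by simp
      then obtain T where T: "T \<subseteq> {e \<in> M. v \<in> e}" "card T = 3"
        using obtain_subset_with_card_n by metis
      then obtain e1 e2 e3 where e: "T = {e1, e2, e3}" "e1 \<noteq> e2" "e1 \<noteq> e3" "e2 \<noteq> e3"
        unfolding card_3_iff by blast
      have nb: "\<exists>y. e = {v, y}" if "e \<in> T" for e
        using simple_graph_edge[OF G, of e v] that T(1) M by blast
      obtain y1 y2 y3 where y: "e1 = {v, y1}" "e2 = {v, y2}" "e3 = {v, y3}"
        using nb[of e1] nb[of e2] nb[of e3] e(1) by auto
      have "{v, y1} \<in> M" "{v, y2} \<in> M" "{v, y3} \<in> M" using T(1) e(1) y by auto
      then have "y1 = y2 \<or> y1 = y3 \<or> y2 = y3" using R by blast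
      then show False using e(2-4) y by auto
    qed
  qed
qed

lemma triangle_free_iff:
  assumes G: "simple_graph V E" and M: "M \<subseteq> E"
  shows "triangle_free M \<longleftrightarrow> (\<forall>x y z. \<not> ({x, y} \<in> M \<and> {y, z} \<in> M \<and> {z, x} \<in> M))"
proof -
  have ne: "x \<noteq> y" if "{x, y} \<in> M" for x y
    using simple_graph_edge[OF G, of "{x, y}" x] that M by (auto simp: doubleton_eq_iff)
  show ?thesis
  proof
    assume t: "triangle_free M"
    show "\<forall>x y z. \<not> ({x, y} \<in> M \<and> {y, z} \<in> M \<and> {z, x} \<in> M)"
    proof (intro allI notI)
      fix x y z assume xyz: "{x, y} \<in> M \<and> {y, z} \<in> M \<and> {z, x} \<in> M"
      then have "is_triangle {{x, y}, {y, z}, {z, x}}"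
        using ne[of x y] ne[of y z] ne[of z x] unfolding is_triangle_def
        by (intro exI[of _ x] exI[of _ y] exI[of _ z]) auto
      then show False using t xyz unfolding triangle_free_def by blast
    qed
  next
    assume no: "\<forall>x y z. \<not> ({x, y} \<in> M \<and> {y, z} \<in> M \<and> {z, x} \<in> M)"
    have False if T: "is_triangle T" "T \<subseteq> M" for T
    proof -
      obtain x y z where "T = {{x, y}, {y, z}, {z, x}}" using T(1) unfolding is_triangle_def by auto
      then show False using T(2) no by simp
    qed
    then show "triangle_free M" unfolding triangle_free_def by blast
  qed
qed

lemma coloured_graph_of_matchings:
  assumes G: "simple_graph V E"
    and M1: "two_matching V E A\<^sub>1" "triangle_free A\<^sub>1"
    and M2: "two_matching V E A\<^sub>2" "triangle_free A\<^sub>2"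
  shows "coloured_graph (\<lambda>x y. {x, y} \<in> A\<^sub>1 - A\<^sub>2) (\<lambda>x y. {x, y} \<in> A\<^sub>2 - A\<^sub>1)
    (\<lambda>x y. {x, y} \<in> A\<^sub>1 \<inter> A\<^sub>2)"
proof
  have sub: "A\<^sub>1 \<subseteq> E" "A\<^sub>2 \<subseteq> E" using M1 M2 unfolding two_matching_def by auto
  have irr: "{x, x} \<notin> E" for x using simple_graph_edge[OF G, of "{x, x}" x] by auto
  fix x y y1 y2 y3 z
  show "{x, x} \<notin> A\<^sub>1 - A\<^sub>2" "{x, x} \<notin> A\<^sub>2 - A\<^sub>1" "{x, x} \<notin> A\<^sub>1 \<inter> A\<^sub>2" using irr[of x] sub by blast+
  show "y1 = y2 \<or> y1 = y3 \<or> y2 = y3"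
    if "{x, y1} \<in> A\<^sub>1 - A\<^sub>2 \<or> {x, y1} \<in> A\<^sub>1 \<inter> A\<^sub>2" "{x, y2} \<in> A\<^sub>1 - A\<^sub>2 \<or> {x, y2} \<in> A\<^sub>1 \<inter> A\<^sub>2"
      "{x, y3} \<in> A\<^sub>1 - A\<^sub>2 \<or> {x, y3} \<in> A\<^sub>1 \<inter> A\<^sub>2"
    using that M1(1)[unfolded two_matching_iff[OF G sub(1)], rule_format, of x y1 y2 y3] by blast
  show "y1 = y2 \<or> y1 = y3 \<or> y2 = y3"
    if "{x, y1} \<in> A\<^sub>2 - A\<^sub>1 \<or> {x, y1} \<in> A\<^sub>1 \<inter> A\<^sub>2" "{x, y2} \<in> A\<^sub>2 - A\<^sub>1 \<or> {x, y2} \<in> A\<^sub>1 \<inter> A\<^sub>2"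
      "{x, y3} \<in> A\<^sub>2 - A\<^sub>1 \<or> {x, y3} \<in> A\<^sub>1 \<inter> A\<^sub>2"
    using that M2(1)[unfolded two_matching_iff[OF G sub(2)], rule_format, of x y1 y2 y3] by blast
  have zx: "{x, z} = {z, x}" by blast
  show "\<not> (({x, y} \<in> A\<^sub>1 - A\<^sub>2 \<or> {x, y} \<in> A\<^sub>1 \<inter> A\<^sub>2) \<and> ({y, z} \<in> A\<^sub>1 - A\<^sub>2 \<or> {y, z} \<in> A\<^sub>1 \<inter> A\<^sub>2) \<and>
      ({x, z} \<in> A\<^sub>1 - A\<^sub>2 \<or> {x, z} \<in> A\<^sub>1 \<inter> A\<^sub>2))"
    using M1(2)[unfolded triangle_free_iff[OF G sub(1)], rule_format, of x y z] unfolding zx by blast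
  show "\<not> (({x, y} \<in> A\<^sub>2 - A\<^sub>1 \<or> {x, y} \<in> A\<^sub>1 \<inter> A\<^sub>2) \<and> ({y, z} \<in> A\<^sub>2 - A\<^sub>1 \<or> {y, z} \<in> A\<^sub>1 \<inter> A\<^sub>2) \<and>
      ({x, z} \<in> A\<^sub>2 - A\<^sub>1 \<or> {x, z} \<in> A\<^sub>1 \<inter> A\<^sub>2))"
    using M2(2)[unfolded triangle_free_iff[OF G sub(2)], rule_format, of x y z] unfolding zx by blast
qed (auto simp: insert_commute)

theorem theorem1:
  fixes V :: "'a set" and E A\<^sub>1 A\<^sub>2 :: "'a set set"
  assumes "simple_graph V E"
    and "two_matching V E A\<^sub>1" and "triangle_free A\<^sub>1"
    and "two_matching V E A\<^sub>2" and "triangle_free A\<^sub>2"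
  shows "\<exists>\<P>. partition_on (sym_diff A\<^sub>1 A\<^sub>2) \<P> \<and>
           (\<forall>P\<in>\<P>. (\<exists>us. alternating_trail E A\<^sub>1 A\<^sub>2 us \<and> P = set (walk_edges us)) \<and>
              (\<forall>A\<in>{A\<^sub>1, A\<^sub>2}. two_matching V E (sym_diff A P) \<and> triangle_free (sym_diff A P)))"
proof -
  let ?R = "\<lambda>x y. {x, y} \<in> A\<^sub>1 - A\<^sub>2" and ?B = "\<lambda>x y. {x, y} \<in> A\<^sub>2 - A\<^sub>1"
  let ?D = "sym_diff A\<^sub>1 A\<^sub>2"
  note G = assms(1)
  have sub: "A\<^sub>1 \<subseteq> E" "A\<^sub>2 \<subseteq> E" using assms unfolding two_matching_def by auto
  interpret coloured_graph ?R ?B "\<lambda>x y. {x, y} \<in> A\<^sub>1 \<inter> A\<^sub>2"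
    using assms by (rule coloured_graph_of_matchings)
  have fin: "finite {v. \<exists>w. edge v w}"
  proof (rule finite_subset)
    show "{v. \<exists>w. edge v w} \<subseteq> V"
    proof
      fix v assume "v \<in> {v. \<exists>w. edge v w}"
      then obtain w where "{v, w} \<in> E" using sub unfolding edge_def by blast
      then show "v \<in> V" using simple_graph_edge[OF G] by blast
    qed
    show "finite V" using G unfolding simple_graph_def by blast
  qed
  obtain q where q: "pairing q" and mix: "\<And>u v w. mixed u v w \<Longrightarrow>
      \<exists>a b c d. {a, b, c, d} \<subseteq> {u, v, w} \<and> ?R a b \<and> ?B c d \<and> ({a, b}, {c, d}) \<in> (link q)\<^sup>*"
    using pairing_connecting_mixed_triangles[OF fin] by metis
  have link_D: "e \<in> ?D" "f \<in> ?D" if "(e, f) \<in> link q" for e f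
    using that pairing_colours[OF q] unfolding link_def by blast+
  have conn_D: "f \<in> ?D" if "(e, f) \<in> (link q)\<^sup>*" "e \<in> ?D" for e f
    using that by (induction rule: rtrancl_induct) (use link_D in blast)+
  \<comment> \<open>The closure relates every set to itself; the restriction to \<open>?D\<close>
    keeps only classes of differing edges.\<close>
  define r where "r = {(e, f). e \<in> ?D \<and> (e, f) \<in> (link q)\<^sup>*}"
  have "equiv ?D r"
  proof (rule equivI)
    show "r \<subseteq> ?D \<times> ?D" using conn_D unfolding r_def by blast
    show "refl_on ?D r" unfolding refl_on_def r_def by blast
    show "sym r" using conn_D conn_sym unfolding sym_def r_def by blast
    show "trans r" unfolding trans_def r_def by (auto intro: rtrancl_trans)
  qed
  then have "partition_on ?D (?D // r)" by (rule partition_on_quotient)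
  moreover have "(\<exists>us. alternating_trail E A\<^sub>1 A\<^sub>2 us \<and> P = set (walk_edges us)) \<and>
      (\<forall>A\<in>{A\<^sub>1, A\<^sub>2}. two_matching V E (sym_diff A P) \<and> triangle_free (sym_diff A P))"
    if PD: "P \<in> ?D // r" for P
  proof
    obtain e where e: "e \<in> ?D" "P = r `` {e}" using PD by (rule quotientE)
    then have P: "P = (link q)\<^sup>* `` {e}" unfolding r_def by blast
    obtain x y where xy: "e = {x, y}" using e(1) sub G unfolding simple_graph_def by blast
    then obtain us where us: "pairing_walk q us" "P = set (walk_edges us)"
      using class_is_walk[OF fin q, of x y] e(1) P by blast
    have P_sub: "P \<subseteq> ?D" using P e(1) conn_D by blast
    have joined_colours: "walk_edges us ! i \<in> A\<^sub>1 - A\<^sub>2 \<and> walk_edges us ! Suc i \<in> A\<^sub>2 - A\<^sub>1 \<or>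
        walk_edges us ! i \<in> A\<^sub>2 - A\<^sub>1 \<and> walk_edges us ! Suc i \<in> A\<^sub>1 - A\<^sub>2"
      if "Suc i < length (walk_edges us)" for i
    proof -
      have i: "Suc (Suc i) < length us" using that by (simp add: length_walk_edges)
      then have "joined q (us ! Suc i) (us ! i) (us ! Suc (Suc i))"
        using us(1) unfolding pairing_walk_def by blast
      moreover have "walk_edges us ! i = {us ! Suc i, us ! i}"
        "walk_edges us ! Suc i = {us ! Suc i, us ! Suc (Suc i)}"
        using walk_edges_nth[of i us] walk_edges_nth[of "Suc i" us] i by auto
      ultimately show ?thesis using pairing_colours[OF q] by metis
    qed
    have "alternating_trail E A\<^sub>1 A\<^sub>2 us"
      unfolding alternating_trail_def is_trail_def
    proof (intro conjI allI impI)
      show "2 \<le> length us" "distinct (walk_edges us)" using us(1) unfolding pairing_walk_def by blast+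
      show "set (walk_edges us) \<subseteq> ?D" using P_sub us(2) by blast
      then show "set (walk_edges us) \<subseteq> E" using sub by blast
    qed (rule joined_colours)
    then show "\<exists>us. alternating_trail E A\<^sub>1 A\<^sub>2 us \<and> P = set (walk_edges us)" using us(2) by blast
    have closed: "e' \<in> P \<longleftrightarrow> f \<in> P" if "(e', f) \<in> link q" for e' f
      using that symD[OF sym_link that] unfolding P by (auto intro: rtrancl_into_rtrancl)
    then have closed': "e' \<in> - P \<longleftrightarrow> f \<in> - P" if "(e', f) \<in> link q" for e' f
      using that by blast
    have sd1: "{x, y} \<in> sym_diff A\<^sub>1 P \<longleftrightarrow> switched P x y" for x y
      using P_sub unfolding switched_def by blast
    \<comment> \<open>For \<open>A\<^sub>2\<close> the colours trade places, which amounts to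
      complementing \<open>P\<close>; closure under \<open>link\<close> passes to the complement, so
      the same lemmas serve both matchings.\<close>
    have sd2: "{x, y} \<in> sym_diff A\<^sub>2 P \<longleftrightarrow> switched (- P) x y" for x y
      using P_sub unfolding switched_def by blast
    have sdE: "sym_diff A\<^sub>1 P \<subseteq> E" "sym_diff A\<^sub>2 P \<subseteq> E" using P_sub sub by blast+
    have "two_matching V E (sym_diff A\<^sub>1 P)" "two_matching V E (sym_diff A\<^sub>2 P)"
      unfolding two_matching_iff[OF G sdE(1)] two_matching_iff[OF G sdE(2)] sd1 sd2
      using switched_degree[OF q closed] switched_degree[OF q closed'] by blast+
    moreover have "triangle_free (sym_diff A\<^sub>1 P)" "triangle_free (sym_diff A\<^sub>2 P)"
      unfolding triangle_free_iff[OF G sdE(1)] triangle_free_iff[OF G sdE(2)] sd1 sd2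
      using switched_triangle_free[OF mix closed] switched_triangle_free[OF mix closed'] by blast+
    ultimately show "\<forall>A\<in>{A\<^sub>1, A\<^sub>2}. two_matching V E (sym_diff A P) \<and> triangle_free (sym_diff A P)"
      by blast
  qed
  ultimately show ?thesis by blast
qed

end
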